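(* Let $N\geq 2$ and let $w\in\ell_N$ be an admissible sequence. Let $X=d_*(w,1)$ and let $Y$ be a strictly convex Banach space. There exists an $N$-homogeneous polynomial $Q\in\mathcal{P}(^N X;Y)$ such that $$Q\notin\overline{\operatorname{NA}_v\mathcal{A}_u(B_X;Y)}^{\|\cdot\|_\infty}.$$ In particular, the set $\operatorname{NA}_v\mathcal{A}_u(B_X;Y)$ is not $\|\cdot\|_\infty$-dense in $\mathcal{A}_u(B_X;Y)$.
   Context: All Banach spaces are complex; $B_X$ is the open unit ball of $X$ and $\overline{B_X}$ the closed unit ball. An admissible sequence is a decreasing sequence $w=(w_n)_{n\in\mathbb{N}}$ of positive reals with $w_1=1$ and $\lim_n w_n=0$. The Lorentz sequence space $d(w,1)$ associated to an admissible sequence $w$ is the space of all bounded complex sequences $x=(x_n)_n$ with $\|x\|_{w,1}=\sum_n x_n^*w_n<\infty$, where $(x_n^* )_n$ is the decreasing rearrangement of $(|x_n|)_n$; it is endowed with the norm $\|\cdot\|_{w,1}$. $d_*(w,1)$ denotes the predual of $d(w,1)$. $\mathcal{P}(^NX;Y)$ is the Banach space of all $N$-homogeneous polynomials from $X$ into $Y$, i.e. maps $P(x)=A(x,\dots,x)$ with $A$ a continuous symmetric $N$-linear map $X^N\to Y$. $\mathcal{A}_u(B_X;Y)$ is the space of holomorphic functions $f:B_X\to Y$ which are uniformly continuous on $B_X$ (hence bounded, and extending continuously to $\overline{B_X}$). $\|f\|_\infty=\sup_{x\in B_X}\|f(x)\|$ and $\|f\|_v=\sup_{x\in B_X}(1-\|x\|^2)\|f(x)\|$;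 $f$ attains its $v$-norm if there is $x_0\in\overline{B_X}$ with $\|f\|_v=(1-\|x_0\|^2)\|f(x_0)\|$; $\operatorname{NA}_v\mathcal{A}_u(B_X;Y)$ is the set of all $f\in\mathcal{A}_u(B_X;Y)$ attaining their $v$-norm.
   Formalization: The formal theorem additionally assumes that w is not in ℓ_1 (for w in ℓ_1 the predual is a renormed ℓ_1 with the Radon–Nikodým property, and the v-norm attaining functions are dense) and that Y is not {0}; the claim is false in the excluded cases. *)

theory Defs
  imports "HOL-Analysis.Analysis" "HOL-Library.Function_Algebras"
begin

section \<open>Complex vector spaces and complex Banach spaces\<close>

class scaleC =
  fixes scaleC :: "complex \<Rightarrow> 'a \<Rightarrow> 'a"  (infixr \<open>*\<^sub>C\<close> 75)

class complex_vector = scaleC + ab_group_add +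
  assumes scaleC_add_right: "a *\<^sub>C (x + y) = a *\<^sub>C x + a *\<^sub>C y"
    and scaleC_add_left: "(a + b) *\<^sub>C x = a *\<^sub>C x + b *\<^sub>C x"
    and scaleC_scaleC: "a *\<^sub>C b *\<^sub>C x = (a * b) *\<^sub>C x"
    and scaleC_one: "1 *\<^sub>C x = x"

class complex_normed_vector = complex_vector + real_normed_vector +
  assumes scaleR_scaleC: "r *\<^sub>R x = complex_of_real r *\<^sub>C x"
    and norm_scaleC: "norm (a *\<^sub>C x) = cmod a * norm x"

class complex_banach = complex_normed_vector + complete_space

instantiation complex :: complex_banach
begin
definition scaleC_complex :: "complex \<Rightarrow> complex \<Rightarrow> complex"
  where "scaleC_complex a x = a * x"
instance
  by standard (simp_all add: scaleC_complex_def algebra_simps norm_mult scaleR_conv_of_real)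
end

text \<open>Together with \<^theory>\<open>HOL-Library.Function_Algebras\<close>, which provides the pointwise group
  structure, this makes complex sequences a complex vector space.\<close>

instantiation "fun" :: (type, complex_vector) complex_vector
begin
definition scaleC_fun :: "complex \<Rightarrow> ('a \<Rightarrow> 'b) \<Rightarrow> 'a \<Rightarrow> 'b"
  where "scaleC_fun a f = (\<lambda>i. a *\<^sub>C f i)"
instance
  by standard (simp_all add: scaleC_fun_def fun_eq_iff scaleC_add_right scaleC_add_left
      scaleC_scaleC scaleC_one)
end

definition strictly_convex :: "'a::complex_normed_vector itself \<Rightarrow> bool"
  where "strictly_convex T \<longleftrightarrow>
    (\<forall>x y :: 'a. norm x = 1 \<and> norm y = 1 \<and> x \<noteq> y \<longrightarrow> norm ((1/2) *\<^sub>R (x + y)) < 1)"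


section \<open>Holomorphic functions and polynomials on a normed space\<close>

text \<open>Since \<open>d\<^sub>*(w,1)\<close> depends on the term \<open>w\<close> it cannot be a type.  The domain of the
  functions is therefore a normed space given by a carrier \<open>X\<close>, a linear subspace of some
  complex vector space, and a norm \<open>nrm\<close> on it.  Only the values on the carrier (or on its
  unit ball) of the functions below are relevant.\<close>

definition open_unit_ball :: "'a set \<Rightarrow> ('a \<Rightarrow> real) \<Rightarrow> 'a set"
  where "open_unit_ball X nrm = {x \<in> X. nrm x < 1}"

definition closed_unit_ball :: "'a set \<Rightarrow> ('a \<Rightarrow> real) \<Rightarrow> 'a set"
  where "closed_unit_ball X nrm = {x \<in> X. nrm x \<le> 1}"

definition bounded_clinear_on ::
    "'a::complex_vector set \<Rightarrow> ('a \<Rightarrow> real) \<Rightarrow> ('a \<Rightarrow> 'b::complex_normed_vector) \<Rightarrow> bool"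
  where "bounded_clinear_on X nrm L \<longleftrightarrow>
    (\<forall>x\<in>X. \<forall>y\<in>X. L (x + y) = L x + L y) \<and>
    (\<forall>c. \<forall>x\<in>X. L (c *\<^sub>C x) = c *\<^sub>C L x) \<and>
    (\<exists>K. \<forall>x\<in>X. norm (L x) \<le> K * nrm x)"

text \<open>Holomorphic means complex Frechet differentiable at every point of the unit ball.\<close>

definition holomorphic_on_ball ::
    "'a::complex_vector set \<Rightarrow> ('a \<Rightarrow> real) \<Rightarrow> ('a \<Rightarrow> 'b::complex_normed_vector) \<Rightarrow> bool"
  where "holomorphic_on_ball X nrm f \<longleftrightarrow>
    (\<forall>x\<in>open_unit_ball X nrm. \<exists>L. bounded_clinear_on X nrm L \<and>
      (\<forall>\<epsilon>>0. \<exists>\<delta>>0. \<forall>h\<in>X. nrm h < \<delta> \<longrightarrow> norm (f (x + h) - f x - L h) \<le> \<epsilon> * nrm h))"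

definition unif_cont_on_ball ::
    "'a::complex_vector set \<Rightarrow> ('a \<Rightarrow> real) \<Rightarrow> ('a \<Rightarrow> 'b::complex_normed_vector) \<Rightarrow> bool"
  where "unif_cont_on_ball X nrm f \<longleftrightarrow>
    (\<forall>\<epsilon>>0. \<exists>\<delta>>0. \<forall>x\<in>open_unit_ball X nrm. \<forall>y\<in>open_unit_ball X nrm.
      nrm (x - y) < \<delta> \<longrightarrow> norm (f x - f y) < \<epsilon>)"

definition A_u ::
    "'a::complex_vector set \<Rightarrow> ('a \<Rightarrow> real) \<Rightarrow> ('a \<Rightarrow> 'b::complex_normed_vector) set"
  where "A_u X nrm = {f. holomorphic_on_ball X nrm f \<and> unif_cont_on_ball X nrm f}"

text \<open>\<open>N\<close>-linear maps take the list of their \<open>N\<close> arguments.  Continuity is with respect to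
  the product topology on \<open>X\<^sup>N\<close>.\<close>

definition continuous_symmetric_multilinear ::
    "'a::complex_vector set \<Rightarrow> ('a \<Rightarrow> real) \<Rightarrow> nat \<Rightarrow> ('a list \<Rightarrow> 'b::complex_normed_vector) \<Rightarrow> bool"
  where "continuous_symmetric_multilinear X nrm N A \<longleftrightarrow>
    (\<forall>xs. length xs = N \<and> set xs \<subseteq> X \<longrightarrow>
      (\<forall>i<N. \<forall>u\<in>X. \<forall>v\<in>X. \<forall>c.
        A (xs[i := u + v]) = A (xs[i := u]) + A (xs[i := v]) \<and>
        A (xs[i := c *\<^sub>C u]) = c *\<^sub>C A (xs[i := u])) \<and>
      (\<forall>ys. mset ys = mset xs \<longrightarrow> A ys = A xs) \<and>
      (\<forall>\<epsilon>>0. \<exists>\<delta>>0. \<forall>ys. length ys = N \<and> set ys \<subseteq> X \<and> (\<forall>i<N. nrm (ys ! i - xs ! i) < \<delta>) \<longrightarrow>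
        norm (A ys - A xs) < \<epsilon>))"

definition hom_polynomials ::
    "'a::complex_vector set \<Rightarrow> ('a \<Rightarrow> real) \<Rightarrow> nat \<Rightarrow> ('a \<Rightarrow> 'b::complex_normed_vector) set"
  where "hom_polynomials X nrm N =
    {P. \<exists>A. continuous_symmetric_multilinear X nrm N A \<and> (\<forall>x\<in>X. P x = A (replicate N x))}"

text \<open>The two suprema are only applied to functions that are bounded on the unit ball:
  members of \<open>A_u\<close>, polynomials, and differences of such functions.\<close>

definition sup_norm :: "'a set \<Rightarrow> ('a \<Rightarrow> real) \<Rightarrow> ('a \<Rightarrow> 'b::complex_normed_vector) \<Rightarrow> real"
  where "sup_norm X nrm f = (SUP x\<in>open_unit_ball X nrm. norm (f x))"

definition v_norm :: "'a set \<Rightarrow> ('a \<Rightarrow> real) \<Rightarrow> ('a \<Rightarrow> 'b::complex_normed_vector) \<Rightarrow> real"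
  where "v_norm X nrm f = (SUP x\<in>open_unit_ball X nrm. (1 - (nrm x)\<^sup>2) * norm (f x))"

text \<open>For \<open>nrm x\<^sub>0 = 1\<close> the weight is \<open>0\<close>, so it does not matter that the value at \<open>x\<^sub>0\<close> of a
  member of \<open>A_u\<close> need not be that of its continuous extension to the closed ball.\<close>

definition attains_v_norm ::
    "'a set \<Rightarrow> ('a \<Rightarrow> real) \<Rightarrow> ('a \<Rightarrow> 'b::complex_normed_vector) \<Rightarrow> bool"
  where "attains_v_norm X nrm f \<longleftrightarrow>
    (\<exists>x\<^sub>0\<in>closed_unit_ball X nrm. v_norm X nrm f = (1 - (nrm x\<^sub>0)\<^sup>2) * norm (f x\<^sub>0))"

definition NA_v_A_u ::
    "'a::complex_vector set \<Rightarrow> ('a \<Rightarrow> real) \<Rightarrow> ('a \<Rightarrow> 'b::complex_normed_vector) set"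
  where "NA_v_A_u X nrm = {f \<in> A_u X nrm. attains_v_norm X nrm f}"

definition sup_norm_closure :: "'a set \<Rightarrow> ('a \<Rightarrow> real) \<Rightarrow>
    ('a \<Rightarrow> 'b::complex_normed_vector) set \<Rightarrow> ('a \<Rightarrow> 'b) set"
  where "sup_norm_closure X nrm S = {f. \<forall>\<epsilon>>0. \<exists>g\<in>S. sup_norm X nrm (f - g) < \<epsilon>}"


section \<open>Lorentz sequence spaces and their preduals\<close>

text \<open>Sequences are indexed from \<open>0\<close>.\<close>

definition admissible :: "(nat \<Rightarrow> real) \<Rightarrow> bool"
  where "admissible w \<longleftrightarrow> decseq w \<and> (\<forall>n. 0 < w n) \<and> w 0 = 1 \<and> w \<longlonglongrightarrow> 0"

text \<open>The decreasing rearrangement of a bounded sequence: the least \<open>t\<close> such that at most \<open>n\<close>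
  terms exceed \<open>t\<close> in modulus.\<close>

definition dec_rearr :: "(nat \<Rightarrow> complex) \<Rightarrow> nat \<Rightarrow> real"
  where "dec_rearr x n =
    Inf {t. 0 \<le> t \<and> finite {k. t < cmod (x k)} \<and> card {k. t < cmod (x k)} \<le> n}"

definition lorentz_space :: "(nat \<Rightarrow> real) \<Rightarrow> (nat \<Rightarrow> complex) set"
  where "lorentz_space w = {x. bounded (range x) \<and> summable (\<lambda>n. dec_rearr x n * w n)}"

definition lorentz_norm :: "(nat \<Rightarrow> real) \<Rightarrow> (nat \<Rightarrow> complex) \<Rightarrow> real"
  where "lorentz_norm w x = (\<Sum>n. dec_rearr x n * w n)"

text \<open>The predual \<open>d\<^sub>*(w,1)\<close> in its usual description (Sargent, Garling) as a sequence space,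
  valid for non-summable \<open>w\<close>.  That it is a normed space and that its dual is \<open>d(w,1)\<close>,
  isometrically and with respect to the pairing \<open>\<Sum>n. x n * y n\<close>, is proved below.\<close>

definition predual_mean :: "(nat \<Rightarrow> real) \<Rightarrow> (nat \<Rightarrow> complex) \<Rightarrow> nat \<Rightarrow> real"
  where "predual_mean w x n = (\<Sum>k\<le>n. dec_rearr x k) / (\<Sum>k\<le>n. w k)"

definition predual_space :: "(nat \<Rightarrow> real) \<Rightarrow> (nat \<Rightarrow> complex) set"
  where "predual_space w = {x. bounded (range x) \<and> predual_mean w x \<longlonglongrightarrow> 0}"

definition predual_norm :: "(nat \<Rightarrow> real) \<Rightarrow> (nat \<Rightarrow> complex) \<Rightarrow> real"
  where "predual_norm w x = (SUP n. predual_mean w x n)"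


section \<open>The dual of \<open>d\<^sub>*(w,1)\<close> is \<open>d(w,1)\<close>\<close>

subsection \<open>The decreasing rearrangement\<close>

lemma dec_rearr_set_nonempty:
  assumes "bounded (range x)"
  shows "{t. 0 \<le> t \<and> finite {k. t < cmod (x k)} \<and> card {k. t < cmod (x k)} \<le> n} \<noteq> {}"
proof -
  obtain B where B: "\<And>k. cmod (x k) \<le> B"
    using assms by (auto simp: bounded_iff)
  then have "\<not> max B 0 < cmod (x k)" for k
    by (simp add: not_less le_max_iff_disj)
  then have "{k. max B 0 < cmod (x k)} = {}"
    by blast
  then have "max B 0 \<in> {t. 0 \<le> t \<and> finite {k. t < cmod (x k)} \<and> card {k. t < cmod (x k)} \<le> n}"
    by (simp only: mem_Collect_eq finite.emptyI card.empty) simp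
  then show ?thesis by blast
qed

lemma dec_rearr_ge:
  assumes "bounded (range x)" "n < card G" "\<And>k. k \<in> G \<Longrightarrow> t \<le> cmod (x k)"
  shows "t \<le> dec_rearr x n"
  unfolding dec_rearr_def
proof (rule cInf_greatest[OF dec_rearr_set_nonempty[OF assms(1)]], rule ccontr)
  fix s assume s: "s \<in> {t. 0 \<le> t \<and> finite {k. t < cmod (x k)} \<and> card {k. t < cmod (x k)} \<le> n}"
    and "\<not> t \<le> s"
  then have "G \<subseteq> {k. s < cmod (x k)}"
    using assms(3) by fastforce
  then have "card G \<le> n"
    using s card_mono[of "{k. s < cmod (x k)}" G] by auto
  then show False using assms(2) by simp
qed

lemma dec_rearr_le:
  assumes "0 \<le> t" "finite {k. t < cmod (x k)}" "card {k. t < cmod (x k)} \<le> n"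
  shows "dec_rearr x n \<le> t"
  unfolding dec_rearr_def by (rule cInf_lower) (use assms in \<open>auto intro: bdd_belowI[of _ 0]\<close>)

lemma dec_rearr_nonneg: "bounded (range x) \<Longrightarrow> 0 \<le> dec_rearr x n"
  by (rule dec_rearr_ge[where G = "{..n}"]) auto

lemma dec_rearr_gtD:
  assumes "t < dec_rearr x n"
  shows "\<exists>G. finite G \<and> card G = Suc n \<and> (\<forall>k\<in>G. t < cmod (x k))"
proof (cases "0 \<le> t")
  case False
  then show ?thesis
    by (intro exI[of _ "{..n}"]) (auto intro: less_le_trans[OF _ norm_ge_zero])
next
  case True
  with assms have "\<not> (finite {k. t < cmod (x k)} \<and> card {k. t < cmod (x k)} \<le> n)"
    using dec_rearr_le[of t x n] by auto
  then have "infinite {k. t < cmod (x k)} \<or> Suc n \<le> card {k. t < cmod (x k)}" by auto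
  then show ?thesis
  proof
    assume "infinite {k. t < cmod (x k)}"
    then show ?thesis
      using infinite_arbitrarily_large[of "{k. t < cmod (x k)}" "Suc n"] by blast
  next
    assume "Suc n \<le> card {k. t < cmod (x k)}"
    then obtain G where "G \<subseteq> {k. t < cmod (x k)}" "card G = Suc n" "finite G"
      by (rule obtain_subset_with_card_n)
    then show ?thesis by (intro exI[of _ G]) auto
  qed
qed

lemma dec_rearr_mono:
  assumes "bounded (range y)" "\<And>k. cmod (x k) \<le> cmod (y k)"
  shows "dec_rearr x n \<le> dec_rearr y n"
proof (rule ccontr)
  assume "\<not> ?thesis"
  then have "dec_rearr y n < dec_rearr x n" by simp
  then obtain t where t: "dec_rearr y n < t" "t < dec_rearr x n"
    using dense by blast
  obtain G where "finite G" "card G = Suc n" "\<forall>k\<in>G. t < cmod (x k)"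
    using dec_rearr_gtD[OF t(2)] by blast
  then have "t \<le> dec_rearr y n"
    by (intro dec_rearr_ge[OF assms(1), of n G]) (auto intro: order_trans[OF less_imp_le assms(2)])
  with t show False by simp
qed

lemma dec_rearr_decseq:
  assumes "bounded (range x)"
  shows "decseq (dec_rearr x)"
proof (rule decseq_SucI, rule ccontr)
  fix n assume "\<not> dec_rearr x (Suc n) \<le> dec_rearr x n"
  then obtain t where t: "dec_rearr x n < t" "t < dec_rearr x (Suc n)"
    using dense[of "dec_rearr x n" "dec_rearr x (Suc n)"] by auto
  obtain G where "finite G" "card G = Suc (Suc n)" "\<forall>k\<in>G. t < cmod (x k)"
    using dec_rearr_gtD[OF t(2)] by blast
  then have "t \<le> dec_rearr x n"
    by (intro dec_rearr_ge[OF assms, of n G]) auto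
  with t show False by simp
qed

lemma dec_rearr_selection:
  assumes "0 < \<epsilon>"
  shows "\<exists>a. inj_on a {..<m} \<and> (\<forall>i<m. dec_rearr x i - \<epsilon> < cmod (x (a i)))"
proof (induction m)
  case 0
  show ?case by simp
next
  case (Suc m)
  then obtain a where a: "inj_on a {..<m}" "\<forall>i<m. dec_rearr x i - \<epsilon> < cmod (x (a i))" by blast
  obtain G where G: "finite G" "card G = Suc m" "\<forall>k\<in>G. dec_rearr x m - \<epsilon> < cmod (x k)"
    using dec_rearr_gtD[of "dec_rearr x m - \<epsilon>" x m] assms by auto
  have "card (a ` {..<m}) < card G"
    using G card_image_le[of "{..<m}" a] by simp
  then obtain k where k: "k \<in> G" "k \<notin> a ` {..<m}"
    by (metis card_mono finite_imageI finite_lessThan not_less subsetI)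
  have "inj_on (a(m := k)) {..<Suc m}"
    using a(1) k(2) by (auto simp: inj_on_def less_Suc_eq)
  moreover have "\<forall>i<Suc m. dec_rearr x i - \<epsilon> < cmod (x ((a(m := k)) i))"
    using a(2) G(3) k(1) by (auto simp: less_Suc_eq)
  ultimately show ?case by blast
qed

lemma decreasing_enumeration:
  fixes f :: "'a \<Rightarrow> real"
  assumes "finite F" "card F = m"
  shows "\<exists>a. bij_betw a {..<m} F \<and> (\<forall>i j. i \<le> j \<and> j < m \<longrightarrow> f (a j) \<le> f (a i))"
  using assms
proof (induction m arbitrary: F)
  case 0
  then show ?case by (auto simp: bij_betw_def)
next
  case (Suc m)
  then have ne: "F \<noteq> {}" by auto
  then obtain k where k: "k \<in> F" "\<And>j. j \<in> F \<Longrightarrow> f k \<le> f j"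
    using Suc.prems(1) by (metis (mono_tags, lifting) arg_min_if_finite(1) arg_min_least)
  obtain a where a: "bij_betw a {..<m} (F - {k})"
      "\<And>i j. i \<le> j \<Longrightarrow> j < m \<Longrightarrow> f (a j) \<le> f (a i)"
    using Suc.IH[of "F - {k}"] Suc.prems k(1) by auto
  have mem: "a i \<in> F - {k}" if "i < m" for i
    using a(1) that by (auto simp: bij_betw_def)
  have "bij_betw (a(m := k)) {..<Suc m} F"
  proof -
    have "bij_betw (a(m := k)) {..<m} (F - {k})"
      using a(1) by (rule bij_betw_cong[THEN iffD1, rotated]) auto
    then have "bij_betw (a(m := k)) (insert m {..<m}) (insert k (F - {k}))"
      using mem by (intro bij_betw_combine[of _ "{m}" "{k}" "{..<m}", simplified]) (auto simp: bij_betw_def)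
    moreover have "insert k (F - {k}) = F" using k(1) by auto
    ultimately show ?thesis by (simp add: lessThan_Suc)
  qed
  moreover have "\<forall>i j. i \<le> j \<and> j < Suc m \<longrightarrow> f ((a(m := k)) j) \<le> f ((a(m := k)) i)"
    using a(2) k(2) mem by (auto simp: less_Suc_eq)
  ultimately show ?case by blast
qed

lemma abel_sum_mono:
  fixes u v b :: "nat \<Rightarrow> real"
  assumes "\<And>n. n \<le> m \<Longrightarrow> (\<Sum>i<n. u i) \<le> (\<Sum>i<n. v i)"
    and dec: "\<And>i j. i \<le> j \<Longrightarrow> j < m \<Longrightarrow> b j \<le> b i" and "\<And>i. i < m \<Longrightarrow> 0 \<le> b i"
  shows "(\<Sum>i<m. u i * b i) \<le> (\<Sum>i<m. v i * b i)"
proof -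
  have key: "(\<Sum>i<Suc n. (v i - u i) * b i) \<ge> (\<Sum>i<Suc n. v i - u i) * b n" if "n < m" for n
    using that
  proof (induction n)
    case 0
    then show ?case by simp
  next
    case (Suc n)
    have "0 \<le> (\<Sum>i<Suc n. v i - u i)"
      using assms(1)[of "Suc n"] Suc.prems by (simp add: sum_subtractf)
    then have "(\<Sum>i<Suc n. v i - u i) * b (Suc n) \<le> (\<Sum>i<Suc n. v i - u i) * b n"
      using dec[of n "Suc n"] Suc.prems by (intro mult_left_mono) auto
    also have "\<dots> \<le> (\<Sum>i<Suc n. (v i - u i) * b i)"
      using Suc by simp
    finally show ?case
      by (subst (1 2) sum.lessThan_Suc) (simp add: distrib_right)
  qed
  show ?thesis
  proof (cases m)
    case (Suc n)
    have "0 \<le> (\<Sum>i<Suc n. v i - u i) * b n"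
      using assms(1)[of "Suc n"] assms(3)[of n] Suc by (simp add: sum_subtractf)
    also have "\<dots> \<le> (\<Sum>i<Suc n. (v i - u i) * b i)"
      using key[of n] Suc by simp
    finally show ?thesis
      using Suc by (simp add: left_diff_distrib sum_subtractf)
  qed simp
qed

lemma sum_le_sum_dec_rearr:
  assumes "bounded (range x)" "inj_on a {..<n}"
  shows "(\<Sum>i<n. cmod (x (a i))) \<le> (\<Sum>i<n. dec_rearr x i)"
proof -
  let ?F = "a ` {..<n}"
  have F: "finite ?F" "card ?F = n"
    using assms(2) by (simp_all add: card_image)
  obtain c where c: "bij_betw c {..<n} ?F"
      "\<And>i j. i \<le> j \<Longrightarrow> j < n \<Longrightarrow> cmod (x (c j)) \<le> cmod (x (c i))"
    using decreasing_enumeration[OF F, of "\<lambda>k. cmod (x k)"] by blast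
  have "(\<Sum>i<n. cmod (x (a i))) = (\<Sum>k\<in>?F. cmod (x k))"
    using assms(2) by (simp add: sum.reindex)
  also have "\<dots> = (\<Sum>i<n. cmod (x (c i)))"
    by (rule sum.reindex_bij_betw[OF c(1), symmetric])
  also have "\<dots> \<le> (\<Sum>i<n. dec_rearr x i)"
  proof (rule sum_mono)
    fix i assume "i \<in> {..<n}"
    then have i: "i < n" by simp
    have "inj_on c {..i}"
      using c(1) i by (auto simp: bij_betw_def inj_on_def)
    then have "card (c ` {..i}) = Suc i" by (simp add: card_image)
    then show "cmod (x (c i)) \<le> dec_rearr x i"
      using c(2) i by (intro dec_rearr_ge[OF assms(1), of i "c ` {..i}"]) auto
  qed
  finally show ?thesis .
qed

lemma dec_rearr_scaleC:
  assumes "bounded (range x)"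
  shows "dec_rearr (c *\<^sub>C x) n = cmod c * dec_rearr x n"
proof -
  have bnd: "bounded (range (a *\<^sub>C z))" if bz: "bounded (range z)" for a :: complex and z :: "nat \<Rightarrow> complex"
  proof -
    obtain B where "\<And>k. cmod (z k) \<le> B"
      using bz by (auto simp: bounded_iff)
    then have "\<And>k. cmod ((a *\<^sub>C z) k) \<le> cmod a * B"
      by (simp add: scaleC_fun_def scaleC_complex_def norm_mult mult_left_mono)
    then show ?thesis by (auto simp: bounded_iff)
  qed
  have le: "dec_rearr (a *\<^sub>C z) n \<le> cmod a * dec_rearr z n"
    if z: "bounded (range z)" for a :: complex and z :: "nat \<Rightarrow> complex"
  proof (cases "a = 0")
    case True
    then show ?thesis
      using dec_rearr_le[of 0 "a *\<^sub>C z" n] by (simp add: scaleC_fun_def scaleC_complex_def)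
  next
    case False
    show ?thesis
    proof (rule dense_le)
      fix t assume "t < dec_rearr (a *\<^sub>C z) n"
      then obtain G where G: "card G = Suc n" "\<forall>k\<in>G. t < cmod ((a *\<^sub>C z) k)"
        using dec_rearr_gtD by blast
      have "t / cmod a \<le> dec_rearr z n"
        using G False
        by (intro dec_rearr_ge[OF z, of n G])
           (auto simp: scaleC_fun_def scaleC_complex_def norm_mult divide_le_eq mult.commute
             intro: less_imp_le)
      then show "t \<le> cmod a * dec_rearr z n"
        using False by (simp add: divide_le_eq mult.commute)
    qed
  qed
  show ?thesis
  proof (cases "c = 0")
    case True
    then show ?thesis
      using le[OF assms, of c] dec_rearr_nonneg[OF bnd[OF assms], of c n] by simp
  next
    case False
    have "dec_rearr x n = dec_rearr (inverse c *\<^sub>C c *\<^sub>C x) n"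
      using False by (simp add: scaleC_scaleC scaleC_one)
    also have "\<dots> \<le> cmod (inverse c) * dec_rearr (c *\<^sub>C x) n"
      by (rule le[OF bnd[OF assms]])
    finally have "cmod c * dec_rearr x n \<le> dec_rearr (c *\<^sub>C x) n"
      using False by (simp add: norm_divide field_simps)
    with le[OF assms, of c] show ?thesis by simp
  qed
qed

lemma sum_dec_rearr_add_le:
  assumes "bounded (range x)" "bounded (range y)"
  shows "(\<Sum>i<n. dec_rearr (x + y) i) \<le> (\<Sum>i<n. dec_rearr x i) + (\<Sum>i<n. dec_rearr y i)"
proof (rule field_le_epsilon)
  fix \<epsilon> :: real assume "0 < \<epsilon>"
  define \<eta> where "\<eta> = \<epsilon> / (real n + 1)"
  have \<eta>: "0 < \<eta>" using \<open>0 < \<epsilon>\<close> by (simp add: \<eta>_def)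
  obtain a where a: "inj_on a {..<n}" "\<And>i. i < n \<Longrightarrow> dec_rearr (x + y) i - \<eta> < cmod ((x + y) (a i))"
    using dec_rearr_selection[OF \<eta>, of n "x + y"] by blast
  have "(\<Sum>i<n. dec_rearr (x + y) i) \<le> (\<Sum>i<n. cmod (x (a i)) + cmod (y (a i)) + \<eta>)"
  proof (rule sum_mono)
    fix i assume "i \<in> {..<n}"
    then show "dec_rearr (x + y) i \<le> cmod (x (a i)) + cmod (y (a i)) + \<eta>"
      using a(2)[of i] norm_triangle_ineq[of "x (a i)" "y (a i)"] by simp
  qed
  also have "\<dots> = (\<Sum>i<n. cmod (x (a i))) + (\<Sum>i<n. cmod (y (a i))) + real n * \<eta>"
    by (simp add: sum.distrib)
  also have "real n * \<eta> \<le> \<epsilon>"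
    using \<open>0 < \<epsilon>\<close> by (simp add: \<eta>_def field_simps)
  finally show "(\<Sum>i<n. dec_rearr (x + y) i) \<le> (\<Sum>i<n. dec_rearr x i) + (\<Sum>i<n. dec_rearr y i) + \<epsilon>"
    using sum_le_sum_dec_rearr[OF assms(1) a(1)] sum_le_sum_dec_rearr[OF assms(2) a(1)] by simp
qed

lemma hardy_littlewood:
  assumes x: "bounded (range x)" and y: "bounded (range y)" and w: "\<And>n. 0 \<le> w n"
    and C: "\<And>n. (\<Sum>i<n. dec_rearr x i) \<le> C * (\<Sum>i<n. w i)" and "0 \<le> C" "finite F"
  shows "(\<Sum>k\<in>F. cmod (x k) * cmod (y k)) \<le> C * (\<Sum>i<card F. dec_rearr y i * w i)"
proof -
  let ?m = "card F"
  obtain a where a: "bij_betw a {..<?m} F"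
      "\<And>i j. i \<le> j \<Longrightarrow> j < ?m \<Longrightarrow> cmod (y (a j)) \<le> cmod (y (a i))"
    using decreasing_enumeration[OF \<open>finite F\<close> refl, of "\<lambda>k. cmod (y k)"] by blast
  have inj: "inj_on a {..<n}" if "n \<le> ?m" for n
    using a(1) that by (auto simp: bij_betw_def inj_on_def)
  have ya: "cmod (y (a i)) \<le> dec_rearr y i" if "i < ?m" for i
  proof -
    have "inj_on a {..i}"
      using inj[of "Suc i"] that by (simp add: lessThan_Suc_atMost)
    then have "card (a ` {..i}) = Suc i" by (simp add: card_image)
    then show ?thesis
      using a(2) that by (intro dec_rearr_ge[OF y, of i "a ` {..i}"]) auto
  qed
  have "(\<Sum>k\<in>F. cmod (x k) * cmod (y k)) = (\<Sum>i<?m. cmod (x (a i)) * cmod (y (a i)))"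
    using sum.reindex_bij_betw[OF a(1), of "\<lambda>k. cmod (x k) * cmod (y k)"] by simp
  also have "\<dots> \<le> (\<Sum>i<?m. (C * w i) * cmod (y (a i)))"
  proof (rule abel_sum_mono)
    fix n assume "n \<le> ?m"
    then show "(\<Sum>i<n. cmod (x (a i))) \<le> (\<Sum>i<n. C * w i)"
      using order_trans[OF sum_le_sum_dec_rearr[OF x inj] C[of n]]
      by (simp add: sum_distrib_left)
  qed (use a(2) in auto)
  also have "\<dots> \<le> (\<Sum>i<?m. (C * w i) * dec_rearr y i)"
    using ya w \<open>0 \<le> C\<close> by (intro sum_mono mult_left_mono) auto
  also have "\<dots> = C * (\<Sum>i<?m. dec_rearr y i * w i)"
    by (simp add: sum_distrib_left mult_ac)
  finally show ?thesis .
qed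


subsection \<open>Elements of \<open>d\<^sub>*(w,1)\<close>\<close>

context
  fixes w :: "nat \<Rightarrow> real"
  assumes adm: "admissible w" and nsum: "\<not> summable w"
begin

lemma w_pos: "0 < w n" and w_nonneg: "0 \<le> w n" and w_dec: "decseq w" and w_0: "w 0 = 1"
  using adm by (auto simp: admissible_def less_imp_le)

lemma w_le_1: "w n \<le> 1"
  using decseqD[OF w_dec, of 0 n] w_0 by simp

lemma W_ge_1: "1 \<le> (\<Sum>k\<le>n. w k)"
  using member_le_sum[of 0 "{..n}" w] w_nonneg w_0 by simp

lemma W_pos: "0 < (\<Sum>k\<le>n. w k)"
  using W_ge_1[of n] by simp

lemma W_at_top: "filterlim (\<lambda>n. \<Sum>k\<le>n. w k) at_top sequentially"
proof (rule filterlim_at_top_mono[OF _ always_eventually])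
  have "\<not> bdd_above (range (\<lambda>n. \<Sum>k\<le>n. w k))"
  proof
    assume "bdd_above (range (\<lambda>n. \<Sum>k\<le>n. w k))"
    then obtain B where "\<And>n. (\<Sum>k\<le>n. w k) \<le> B" by (auto simp: bdd_above_def)
    then have "summable w"
      by (intro bounded_imp_summable[where B = B] w_nonneg) auto
    with nsum show False by simp
  qed
  then show "filterlim (\<lambda>n. \<Sum>k\<le>n. w k) at_top sequentially"
    unfolding filterlim_at_top eventually_sequentially
  proof (intro allI)
    fix Z :: real
    assume "\<not> bdd_above (range (\<lambda>n. \<Sum>k\<le>n. w k))"
    then obtain N where "Z \<le> (\<Sum>k\<le>N. w k)"
      by (auto simp: bdd_above_def) (meson less_imp_le not_le)
    moreover have "(\<Sum>k\<le>N. w k) \<le> (\<Sum>k\<le>n. w k)" if "N \<le> n" for n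
      using that w_nonneg by (intro sum_mono2) auto
    ultimately show "\<exists>N. \<forall>n\<ge>N. Z \<le> (\<Sum>k\<le>n. w k)"
      by (meson order_trans)
  qed
qed simp

lemma predual_bounded: "x \<in> predual_space w \<Longrightarrow> bounded (range x)"
  by (simp add: predual_space_def)

lemma predual_mean_nonneg: "bounded (range x) \<Longrightarrow> 0 \<le> predual_mean w x n"
  unfolding predual_mean_def
  by (intro divide_nonneg_pos sum_nonneg dec_rearr_nonneg W_pos)

lemma predual_mean_squeeze:
  assumes "bounded (range x)" "\<And>n. predual_mean w x n \<le> h n" "h \<longlonglongrightarrow> 0"
  shows "predual_mean w x \<longlonglongrightarrow> 0"
  by (rule real_tendsto_sandwich[OF _ _ tendsto_const assms(3)])
     (simp_all add: predual_mean_nonneg assms(1,2))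

lemma predual_mean_le_norm:
  assumes "x \<in> predual_space w"
  shows "predual_mean w x n \<le> predual_norm w x"
proof -
  have "convergent (predual_mean w x)"
    using assms by (auto simp: predual_space_def convergent_def)
  then have "bounded (range (predual_mean w x))"
    using convergent_imp_Bseq Bseq_eq_bounded by blast
  then show ?thesis
    unfolding predual_norm_def by (intro cSUP_upper bounded_imp_bdd_above) auto
qed

lemma predual_norm_nonneg: "x \<in> predual_space w \<Longrightarrow> 0 \<le> predual_norm w x"
  using predual_mean_le_norm predual_mean_nonneg predual_bounded order_trans by blast

lemma predual_norm_le:
  assumes "\<And>n. (\<Sum>k\<le>n. dec_rearr x k) \<le> C * (\<Sum>k\<le>n. w k)"
  shows "predual_norm w x \<le> C"
  unfolding predual_norm_def predual_mean_def
  by (rule cSUP_least) (use assms W_pos in \<open>auto simp: pos_divide_le_eq\<close>)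

lemma sum_dec_rearr_le_norm:
  assumes "x \<in> predual_space w"
  shows "(\<Sum>i<n. dec_rearr x i) \<le> predual_norm w x * (\<Sum>i<n. w i)"
proof (cases n)
  case (Suc m)
  then show ?thesis
    using predual_mean_le_norm[OF assms, of m] W_pos[of m]
    by (simp add: predual_mean_def pos_divide_le_eq lessThan_Suc_atMost)
qed simp

lemma predual_space_mono:
  assumes "y \<in> predual_space w" "\<And>k. cmod (x k) \<le> cmod (y k)"
  shows "x \<in> predual_space w"
proof -
  obtain B where "\<And>k. cmod (y k) \<le> B"
    using predual_bounded[OF assms(1)] by (auto simp: bounded_iff)
  then have bx: "bounded (range x)"
    using assms(2) by (auto simp: bounded_iff intro: order_trans)
  have "predual_mean w x n \<le> predual_mean w y n" for n
    unfolding predual_mean_def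
    by (intro divide_right_mono sum_mono dec_rearr_mono predual_bounded[OF assms(1)] assms(2))
       (use W_pos less_imp_le in blast)
  then have "predual_mean w x \<longlonglongrightarrow> 0"
    using assms(1) by (intro predual_mean_squeeze[OF bx, of "predual_mean w y"]) (auto simp: predual_space_def)
  with bx show ?thesis by (simp add: predual_space_def)
qed

lemma predual_mean_add_le:
  assumes "bounded (range x)" "bounded (range y)"
  shows "predual_mean w (x + y) n \<le> predual_mean w x n + predual_mean w y n"
  using sum_dec_rearr_add_le[OF assms, of "Suc n"] W_pos[of n] less_imp_le
  unfolding predual_mean_def
  by (simp add: lessThan_Suc_atMost divide_right_mono flip: add_divide_distrib)

lemma predual_space_add:
  assumes x: "x \<in> predual_space w" and y: "y \<in> predual_space w"
  shows "x + y \<in> predual_space w"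
    and "predual_norm w (x + y) \<le> predual_norm w x + predual_norm w y"
proof -
  note bx = predual_bounded[OF x] and bny = predual_bounded[OF y]
  obtain B C where "\<And>k. cmod (x k) \<le> B" "\<And>k. cmod (y k) \<le> C"
    using bx bny by (auto simp: bounded_iff)
  then have "\<And>k. cmod ((x + y) k) \<le> B + C"
    by (simp add: norm_triangle_mono)
  then have b: "bounded (range (x + y))" by (auto simp: bounded_iff)
  have "(\<lambda>n. predual_mean w x n + predual_mean w y n) \<longlonglongrightarrow> 0 + 0"
    using x y by (intro tendsto_add) (auto simp: predual_space_def)
  then have "predual_mean w (x + y) \<longlonglongrightarrow> 0"
    by (intro predual_mean_squeeze[OF b predual_mean_add_le[OF bx bny]]) simp
  with b show "x + y \<in> predual_space w" by (simp add: predual_space_def)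
  show "predual_norm w (x + y) \<le> predual_norm w x + predual_norm w y"
    unfolding predual_norm_def[of w "x + y"]
    using predual_mean_add_le[OF bx bny] predual_mean_le_norm[OF x] predual_mean_le_norm[OF y]
    by (intro cSUP_least) (auto intro: order_trans[OF _ add_mono])
qed

lemma predual_space_scaleC:
  assumes x: "x \<in> predual_space w"
  shows "c *\<^sub>C x \<in> predual_space w" and "predual_norm w (c *\<^sub>C x) = cmod c * predual_norm w x"
proof -
  note bx = predual_bounded[OF x]
  obtain B where "\<And>k. cmod (x k) \<le> B"
    using bx by (auto simp: bounded_iff)
  then have "\<And>k. cmod ((c *\<^sub>C x) k) \<le> cmod c * B"
    by (simp add: scaleC_fun_def scaleC_complex_def norm_mult mult_left_mono)
  then have b: "bounded (range (c *\<^sub>C x))" by (auto simp: bounded_iff)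
  have mean: "predual_mean w (c *\<^sub>C x) = (\<lambda>n. cmod c * predual_mean w x n)"
    by (simp add: predual_mean_def dec_rearr_scaleC[OF bx] fun_eq_iff flip: sum_distrib_left)
  have "(\<lambda>n. cmod c * predual_mean w x n) \<longlonglongrightarrow> cmod c * 0"
    using x by (intro tendsto_mult_left) (simp add: predual_space_def)
  with b show cx: "c *\<^sub>C x \<in> predual_space w" by (simp add: predual_space_def mean)
  show "predual_norm w (c *\<^sub>C x) = cmod c * predual_norm w x"
  proof (cases "c = 0")
    case False
    have "predual_mean w x n \<le> predual_norm w (c *\<^sub>C x) / cmod c" for n
      using predual_mean_le_norm[OF cx, of n] False by (simp add: mean pos_le_divide_eq mult.commute)
    then have "predual_norm w x \<le> predual_norm w (c *\<^sub>C x) / cmod c"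
      unfolding predual_norm_def[of w x] by (intro cSUP_least) auto
    then have "cmod c * predual_norm w x \<le> predual_norm w (c *\<^sub>C x)"
      using False by (simp add: pos_le_divide_eq mult.commute)
    moreover have "predual_norm w (c *\<^sub>C x) \<le> cmod c * predual_norm w x"
      unfolding predual_norm_def[of w "c *\<^sub>C x"] mean
      by (intro cSUP_least mult_left_mono predual_mean_le_norm[OF x]) auto
    ultimately show ?thesis by simp
  next
    case True
    then show ?thesis unfolding predual_norm_def mean by simp
  qed
qed

lemma predual_norm_eq_0D:
  assumes x: "x \<in> predual_space w" and "predual_norm w x = 0"
  shows "x = 0"
proof
  fix k
  have "cmod (x k) \<le> dec_rearr x 0"
    by (rule dec_rearr_ge[OF predual_bounded[OF x], of 0 "{k}"]) auto
  also have "\<dots> \<le> predual_norm w x"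
    using sum_dec_rearr_le_norm[OF x, of 1] w_0 by simp
  finally show "x k = 0 k" using assms(2) by simp
qed

lemma finite_support_predual:
  assumes "finite {k. x k \<noteq> 0}"
  shows "x \<in> predual_space w"
proof -
  let ?m = "card {k. x k \<noteq> 0}"
  have "range x \<subseteq> insert 0 (x ` {k. x k \<noteq> 0})" by auto
  then have bx: "bounded (range x)"
    using assms by (meson bounded_subset finite_imageI finite_imp_bounded finite_insert)
  have z: "dec_rearr x k = 0" if "?m \<le> k" for k
    using dec_rearr_le[of 0 x k] dec_rearr_nonneg[OF bx, of k] assms that by simp
  have "predual_mean w x n \<le> (\<Sum>k\<le>?m. dec_rearr x k) / (\<Sum>k\<le>n. w k)" for n
  proof -
    have "(\<Sum>k\<le>n. dec_rearr x k) = (\<Sum>k\<in>{..n} \<inter> {..?m}. dec_rearr x k)"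
      by (rule sum.mono_neutral_right) (auto intro: z)
    also have "\<dots> \<le> (\<Sum>k\<le>?m. dec_rearr x k)"
      by (rule sum_mono2) (auto intro: dec_rearr_nonneg[OF bx])
    finally show ?thesis
      unfolding predual_mean_def using W_pos less_imp_le by (intro divide_right_mono) auto
  qed
  moreover have "(\<lambda>n. (\<Sum>k\<le>?m. dec_rearr x k) / (\<Sum>k\<le>n. w k)) \<longlonglongrightarrow> 0"
    by (rule real_tendsto_divide_at_top[OF tendsto_const W_at_top])
  ultimately have "predual_mean w x \<longlonglongrightarrow> 0"
    by (rule predual_mean_squeeze[OF bx])
  with bx show ?thesis by (simp add: predual_space_def)
qed

lemma predual_null_sequence:
  assumes "x \<in> predual_space w" "0 < \<delta>"
  shows "finite {k. \<delta> < cmod (x k)}"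
proof (rule ccontr)
  assume inf: "infinite {k. \<delta> < cmod (x k)}"
  have R: "\<delta> \<le> dec_rearr x n" for n
  proof -
    obtain G where "finite G" "card G = Suc n" "G \<subseteq> {k. \<delta> < cmod (x k)}"
      using infinite_arbitrarily_large[OF inf, of "Suc n"] by blast
    then show ?thesis
      by (intro dec_rearr_ge[OF predual_bounded[OF assms(1)], of n G]) auto
  qed
  have "\<delta> \<le> predual_mean w x n" for n
  proof -
    have "\<delta> * (\<Sum>k\<le>n. w k) \<le> \<delta> * (\<Sum>k\<le>n. 1)"
      using w_le_1 assms(2) by (intro mult_left_mono sum_mono) auto
    also have "\<dots> = (\<Sum>k\<le>n. \<delta>)" by (simp add: mult.commute)
    also have "\<dots> \<le> (\<Sum>k\<le>n. dec_rearr x k)"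
      using R by (intro sum_mono) auto
    finally show ?thesis
      using W_pos by (simp add: predual_mean_def pos_le_divide_eq)
  qed
  then have "\<delta> \<le> 0"
    using assms(1) by (intro LIMSEQ_le_const[of "predual_mean w x" 0]) (auto simp: predual_space_def)
  with assms(2) show False by simp
qed

lemma predual_truncation:
  assumes x: "x \<in> predual_space w" and "0 < \<epsilon>"
  shows "\<exists>m. \<forall>n\<ge>m. predual_norm w (\<lambda>k. if k < n then 0 else x k) \<le> \<epsilon>"
proof -
  have "eventually (\<lambda>n. predual_mean w x n < \<epsilon>) sequentially"
    using x \<open>0 < \<epsilon>\<close> by (intro order_tendstoD[of _ 0]) (auto simp: predual_space_def)
  then obtain N where N: "\<And>n. N \<le> n \<Longrightarrow> predual_mean w x n < \<epsilon>"
    by (auto simp: eventually_sequentially)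
  define \<delta> where "\<delta> = \<epsilon> / (real N + 1)"
  have \<delta>: "0 < \<delta>" using \<open>0 < \<epsilon>\<close> by (simp add: \<delta>_def)
  have "finite {k. \<delta> < cmod (x k)}" by (rule predual_null_sequence[OF x \<delta>])
  then obtain m where m: "\<And>k. \<delta> < cmod (x k) \<Longrightarrow> k < m"
    by (metis finite_nat_set_iff_bounded mem_Collect_eq)
  have "predual_norm w (\<lambda>k. if k < n then 0 else x k) \<le> \<epsilon>" if "m \<le> n" for n
  proof (rule predual_norm_le)
    fix j
    let ?t = "\<lambda>k. if k < n then 0 else x k"
    show "(\<Sum>k\<le>j. dec_rearr ?t k) \<le> \<epsilon> * (\<Sum>k\<le>j. w k)"
    proof (cases "N \<le> j")
      case True
      have "(\<Sum>k\<le>j. dec_rearr ?t k) \<le> (\<Sum>k\<le>j. dec_rearr x k)"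
        by (intro sum_mono dec_rearr_mono predual_bounded[OF x]) auto
      also have "\<dots> \<le> \<epsilon> * (\<Sum>k\<le>j. w k)"
        using N[OF True] W_pos[of j] by (simp add: predual_mean_def pos_divide_less_eq)
      finally show ?thesis .
    next
      case False
      have "{k. \<delta> < cmod (?t k)} = {}"
        using m \<delta> that by (force split: if_splits)
      then have "dec_rearr ?t k \<le> \<delta>" for k
        using \<delta> by (intro dec_rearr_le) auto
      then have "(\<Sum>k\<le>j. dec_rearr ?t k) \<le> (\<Sum>k\<le>j. \<delta>)"
        by (intro sum_mono) auto
      also have "\<dots> \<le> (real N + 1) * \<delta>"
        using False \<delta> by (simp add: mult_right_mono)
      also have "\<dots> = \<epsilon>" by (simp add: \<delta>_def)
      also have "\<dots> \<le> \<epsilon> * (\<Sum>k\<le>j. w k)"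
        using W_ge_1[of j] \<open>0 < \<epsilon>\<close> by simp
      finally show ?thesis .
    qed
  qed
  then show ?thesis by blast
qed

lemma predual_test_vector:
  assumes "bounded (range y)" "0 < \<epsilon>"
  shows "\<exists>x A. finite A \<and> (\<forall>k. k \<notin> A \<longrightarrow> x k = 0) \<and> predual_norm w x \<le> 1 \<and>
    (\<Sum>i<m. dec_rearr y i * w i) \<le> cmod (\<Sum>k\<in>A. x k * y k) + \<epsilon>"
proof -
  define \<eta> where "\<eta> = \<epsilon> / (real m + 1)"
  have \<eta>: "0 < \<eta>" using assms(2) by (simp add: \<eta>_def)
  obtain a where a: "inj_on a {..<m}" "\<And>i. i < m \<Longrightarrow> dec_rearr y i - \<eta> < cmod (y (a i))"
    using dec_rearr_selection[OF \<eta>, of m y] by blast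
  define A where "A = a ` {..<m}"
  define x where "x k = (if k \<in> A then of_real (w (the_inv_into {..<m} a k)) * cnj (sgn (y k)) else 0)" for k
  have xa: "x (a i) = of_real (w i) * cnj (sgn (y (a i)))" if "i < m" for i
    using that a(1) by (simp add: x_def A_def the_inv_into_f_f)
  have xa_norm: "cmod (x (a i)) \<le> w i" if "i < m" for i
    using xa[OF that] w_nonneg[of i] by (simp add: norm_mult norm_sgn)
  have R: "dec_rearr x i \<le> w i" for i
  proof (rule dec_rearr_le)
    have sub: "{k. w i < cmod (x k)} \<subseteq> a ` {..<i}"
    proof
      fix k assume "k \<in> {k. w i < cmod (x k)}"
      then have k: "w i < cmod (x k)" by simp
      then have "x k \<noteq> 0" using w_nonneg[of i] by auto
      then have "k \<in> A" by (auto simp: x_def split: if_splits)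
      then obtain j where j: "j < m" "k = a j" by (auto simp: A_def)
      then have "w i < w j" using k xa_norm[OF j(1)] by simp
      then have "j < i" using decseqD[OF w_dec, of i j] by (meson not_le)
      then show "k \<in> a ` {..<i}" using j by auto
    qed
    then show "finite {k. w i < cmod (x k)}"
      by (rule finite_subset) simp
    have "card {k. w i < cmod (x k)} \<le> card (a ` {..<i})"
      using sub by (rule card_mono[rotated]) simp
    also have "\<dots> \<le> i" using card_image_le[of "{..<i}" a] by simp
    finally show "card {k. w i < cmod (x k)} \<le> i" .
  qed (rule w_nonneg)
  have 1: "predual_norm w x \<le> 1"
    by (rule predual_norm_le) (simp add: R sum_mono)
  have "(\<Sum>k\<in>A. x k * y k) = (\<Sum>i<m. x (a i) * y (a i))"
    unfolding A_def using a(1) by (simp add: sum.reindex)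
  also have "\<dots> = (\<Sum>i<m. of_real (w i * cmod (y (a i))))"
  proof (rule sum.cong[OF refl])
    fix i assume "i \<in> {..<m}"
    have "cnj (sgn z) * z = of_real (cmod z)" for z :: complex
    proof (cases "z = 0")
      case False
      have "cnj (sgn z) * z = (z * cnj z) / of_real (cmod z)"
        by (simp add: sgn_eq mult.commute)
      also have "\<dots> = of_real (cmod z)"
        using False by (simp add: complex_norm_square[symmetric] power2_eq_square)
      finally show ?thesis .
    qed simp
    then show "x (a i) * y (a i) = of_real (w i * cmod (y (a i)))"
      using \<open>i \<in> {..<m}\<close> by (simp add: xa mult.assoc)
  qed
  finally have "(\<Sum>k\<in>A. x k * y k) = of_real (\<Sum>i<m. w i * cmod (y (a i)))" by simp
  then have S: "cmod (\<Sum>k\<in>A. x k * y k) = (\<Sum>i<m. w i * cmod (y (a i)))"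
    using w_nonneg by (simp only: norm_of_real) (intro abs_of_nonneg sum_nonneg; simp)
  have "(\<Sum>i<m. dec_rearr y i * w i) \<le> (\<Sum>i<m. w i * cmod (y (a i)) + \<eta>)"
  proof (rule sum_mono)
    fix i assume "i \<in> {..<m}"
    then have "dec_rearr y i * w i \<le> (cmod (y (a i)) + \<eta>) * w i"
      using a(2)[of i] w_nonneg[of i] by (intro mult_right_mono) auto
    also have "\<dots> \<le> w i * cmod (y (a i)) + \<eta>"
      using w_le_1[of i] \<eta> by (simp add: algebra_simps)
    finally show "dec_rearr y i * w i \<le> w i * cmod (y (a i)) + \<eta>" .
  qed
  also have "\<dots> = cmod (\<Sum>k\<in>A. x k * y k) + real m * \<eta>"
    by (simp add: S sum.distrib)
  also have "real m * \<eta> \<le> \<epsilon>"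
    using assms(2) by (simp add: \<eta>_def field_simps)
  finally have "(\<Sum>i<m. dec_rearr y i * w i) \<le> cmod (\<Sum>k\<in>A. x k * y k) + \<epsilon>" by simp
  moreover have "finite A" "\<forall>k. k \<notin> A \<longrightarrow> x k = 0" by (simp_all add: A_def x_def)
  ultimately show ?thesis using 1 by (intro exI[of _ x] exI[of _ A]) simp
qed


subsection \<open>Duality\<close>

theorem predual_pairing_summable:
  assumes "x \<in> predual_space w" "y \<in> lorentz_space w"
  shows "summable (\<lambda>n. cmod (x n * y n))"
    and "(\<Sum>n. cmod (x n * y n)) \<le> predual_norm w x * lorentz_norm w y"
proof -
  have bx: "bounded (range x)" and yb: "bounded (range y)"
    and ys: "summable (\<lambda>n. dec_rearr y n * w n)"
    using assms by (auto simp: predual_space_def lorentz_space_def)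
  have le: "(\<Sum>n<m. cmod (x n * y n)) \<le> predual_norm w x * lorentz_norm w y" for m
  proof -
    have "(\<Sum>n<m. cmod (x n * y n)) = (\<Sum>n<m. cmod (x n) * cmod (y n))"
      by (simp add: norm_mult)
    also have "\<dots> \<le> predual_norm w x * (\<Sum>i<m. dec_rearr y i * w i)"
      using hardy_littlewood[OF bx yb w_nonneg sum_dec_rearr_le_norm[OF assms(1)]
          predual_norm_nonneg[OF assms(1)], of "{..<m}"] by simp
    also have "\<dots> \<le> predual_norm w x * lorentz_norm w y"
      unfolding lorentz_norm_def using ys predual_norm_nonneg[OF assms(1)]
        dec_rearr_nonneg[OF yb] w_nonneg
      by (intro mult_left_mono sum_le_suminf) auto
    finally show ?thesis .
  qed
  show s: "summable (\<lambda>n. cmod (x n * y n))"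
    using le by (intro summableI_nonneg_bounded[of _ "predual_norm w x * lorentz_norm w y"]) auto
  show "(\<Sum>n. cmod (x n * y n)) \<le> predual_norm w x * lorentz_norm w y"
    using s le by (rule suminf_le_const)
qed

theorem predual_pairing_bound:
  assumes "x \<in> predual_space w" "y \<in> lorentz_space w"
  shows "cmod (\<Sum>n. x n * y n) \<le> predual_norm w x * lorentz_norm w y"
  using summable_norm[OF predual_pairing_summable(1)[OF assms]]
    predual_pairing_summable(2)[OF assms] by simp

theorem lorentz_norm_eq_dual_norm:
  assumes y: "y \<in> lorentz_space w"
  shows "lorentz_norm w y =
    (SUP x\<in>closed_unit_ball (predual_space w) (predual_norm w). cmod (\<Sum>n. x n * y n))"
    (is "_ = (SUP x\<in>?B. ?f x)")
proof (rule antisym)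
  have yb: "bounded (range y)" and ys: "summable (\<lambda>n. dec_rearr y n * w n)"
    using y by (auto simp: lorentz_space_def)
  have nn: "0 \<le> lorentz_norm w y"
    unfolding lorentz_norm_def using ys dec_rearr_nonneg[OF yb] w_nonneg
    by (intro suminf_nonneg) auto
  have le: "?f x \<le> lorentz_norm w y" if "x \<in> ?B" for x
  proof -
    have "?f x \<le> predual_norm w x * lorentz_norm w y"
      using that y by (intro predual_pairing_bound) (auto simp: closed_unit_ball_def)
    also have "\<dots> \<le> 1 * lorentz_norm w y"
      using that nn by (intro mult_right_mono) (auto simp: closed_unit_ball_def)
    finally show ?thesis by simp
  qed
  have z: "(\<lambda>_. 0) \<in> ?B"
    using finite_support_predual[of "\<lambda>_. 0"]
    by (auto simp: closed_unit_ball_def intro!: predual_norm_le sum_mono order_trans[OF _ less_imp_le[OF w_pos]] dec_rearr_le)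
  show "(SUP x\<in>?B. ?f x) \<le> lorentz_norm w y"
    using z le by (intro cSUP_least) auto
  have bdd: "bdd_above (?f ` ?B)"
    using le by (auto simp: bdd_above_def)
  have "(\<Sum>i<m. dec_rearr y i * w i) \<le> (SUP x\<in>?B. ?f x)" for m
  proof (rule field_le_epsilon)
    fix \<epsilon> :: real assume "0 < \<epsilon>"
    then obtain x A where x: "finite A" "\<forall>k. k \<notin> A \<longrightarrow> x k = 0" "predual_norm w x \<le> 1"
        "(\<Sum>i<m. dec_rearr y i * w i) \<le> cmod (\<Sum>k\<in>A. x k * y k) + \<epsilon>"
      using predual_test_vector[OF yb, of \<epsilon> m] by blast
    have "{k. x k \<noteq> 0} \<subseteq> A" using x(2) by auto
    then have "x \<in> predual_space w"
      using x(1) by (intro finite_support_predual) (rule finite_subset)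
    then have "x \<in> ?B" using x(3) by (simp add: closed_unit_ball_def)
    then have "?f x \<le> (SUP x\<in>?B. ?f x)" by (rule cSUP_upper[OF _ bdd])
    moreover have "(\<Sum>n. x n * y n) = (\<Sum>k\<in>A. x k * y k)"
      using x(1,2) by (intro suminf_finite) auto
    ultimately show "(\<Sum>i<m. dec_rearr y i * w i) \<le> (SUP x\<in>?B. ?f x) + \<epsilon>"
      using x(4) by simp
  qed
  then show "lorentz_norm w y \<le> (SUP x\<in>?B. ?f x)"
    unfolding lorentz_norm_def by (intro suminf_le_const[OF ys]) auto
qed

theorem predual_functional_representation:
  fixes \<phi> :: "(nat \<Rightarrow> complex) \<Rightarrow> complex"
  assumes "bounded_clinear_on (predual_space w) (predual_norm w) \<phi>"
  shows "\<exists>y\<in>lorentz_space w. \<forall>x\<in>predual_space w. \<phi> x = (\<Sum>n. x n * y n)"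
proof -
  let ?X = "predual_space w"
  have add: "\<And>x x'. x \<in> ?X \<Longrightarrow> x' \<in> ?X \<Longrightarrow> \<phi> (x + x') = \<phi> x + \<phi> x'"
    and scale: "\<And>c x. x \<in> ?X \<Longrightarrow> \<phi> (c *\<^sub>C x) = c * \<phi> x"
    and "\<exists>K0. \<forall>x\<in>?X. cmod (\<phi> x) \<le> K0 * predual_norm w x"
    using assms unfolding bounded_clinear_on_def scaleC_complex_def by simp_all
  then obtain K0 where K0: "\<And>x. x \<in> ?X \<Longrightarrow> cmod (\<phi> x) \<le> K0 * predual_norm w x"
    by blast
  define K where "K = max K0 0"
  have K: "cmod (\<phi> x) \<le> K * predual_norm w x" if "x \<in> ?X" for x
  proof -
    have "K0 * predual_norm w x \<le> K * predual_norm w x"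
      using predual_norm_nonneg[OF that] by (intro mult_right_mono) (auto simp: K_def)
    then show ?thesis using K0[OF that] by simp
  qed
  define e :: "nat \<Rightarrow> nat \<Rightarrow> complex" where "e n = (\<lambda>k. if k = n then 1 else 0)" for n
  define y where "y n = \<phi> (e n)" for n
  have eX: "e n \<in> ?X" for n
    by (rule finite_support_predual) (simp add: e_def)
  have zX: "0 \<in> ?X"
    by (rule finite_support_predual) simp
  have fin: "\<phi> x = (\<Sum>k\<in>A. x k * y k)" if "finite A" "\<forall>k. k \<notin> A \<longrightarrow> x k = 0" for x A
    using that
  proof (induction A arbitrary: x rule: finite_induct)
    case empty
    then have "x = 0" by (auto simp: fun_eq_iff)
    moreover have "\<phi> 0 = 0" using add[OF zX zX] by simp
    ultimately show ?case by (simp only: sum.empty)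
  next
    case (insert n A)
    define x' where "x' = x(n := 0)"
    have "{k. x' k \<noteq> 0} \<subseteq> A" using insert.prems by (auto simp: x'_def)
    then have x'X: "x' \<in> ?X"
      using insert.hyps(1) by (intro finite_support_predual) (rule finite_subset)
    have "{k. (x n *\<^sub>C e n) k \<noteq> 0} \<subseteq> {n}"
      by (auto simp: scaleC_fun_def scaleC_complex_def e_def)
    then have enX: "x n *\<^sub>C e n \<in> ?X"
      by (intro finite_support_predual) (rule finite_subset, auto)
    have "x = x' + x n *\<^sub>C e n"
      by (auto simp: fun_eq_iff x'_def e_def scaleC_fun_def scaleC_complex_def)
    then have "\<phi> x = \<phi> x' + x n * y n"
      using add[OF x'X enX] scale[OF eX] by (simp add: y_def)
    also have "\<phi> x' = (\<Sum>k\<in>A. x' k * y k)"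
      using insert.prems by (intro insert.IH) (auto simp: x'_def)
    also have "\<dots> = (\<Sum>k\<in>A. x k * y k)"
      using insert.hyps(2) by (intro sum.cong) (auto simp: x'_def)
    finally show ?case using insert.hyps by simp
  qed
  have e_norm: "predual_norm w (e n) \<le> 1" for n
  proof (rule predual_norm_le)
    fix m
    have "dec_rearr (e n) k \<le> w k" for k
    proof (cases "k = 0")
      case True
      have "{j. w k < cmod (e n j)} = {}" using True w_0 by (auto simp: e_def)
      then show ?thesis using w_nonneg[of k] by (intro dec_rearr_le) auto
    next
      case False
      have "{j. w k < cmod (e n j)} \<subseteq> {n}"
        using w_nonneg[of k] by (auto simp: e_def split: if_splits)
      then have "finite {j. w k < cmod (e n j)}" "card {j. w k < cmod (e n j)} \<le> card {n}"
        by (meson finite.emptyI finite.insertI finite_subset card_mono)+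
      then show ?thesis using False w_nonneg[of k] by (intro dec_rearr_le) auto
    qed
    then show "(\<Sum>k\<le>m. dec_rearr (e n) k) \<le> 1 * (\<Sum>k\<le>m. w k)" by (simp add: sum_mono)
  qed
  have "cmod (y n) \<le> K" for n
  proof -
    have "cmod (y n) \<le> K * predual_norm w (e n)" unfolding y_def by (rule K[OF eX])
    also have "\<dots> \<le> K * 1" using e_norm by (intro mult_left_mono) (auto simp: K_def)
    finally show ?thesis by simp
  qed
  then have yb: "bounded (range y)" by (auto simp: bounded_iff)
  have "(\<Sum>i<m. dec_rearr y i * w i) \<le> K" for m
  proof (rule field_le_epsilon)
    fix \<epsilon> :: real assume "0 < \<epsilon>"
    then obtain x A where x: "finite A" "\<forall>k. k \<notin> A \<longrightarrow> x k = 0" "predual_norm w x \<le> 1"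
        "(\<Sum>i<m. dec_rearr y i * w i) \<le> cmod (\<Sum>k\<in>A. x k * y k) + \<epsilon>"
      using predual_test_vector[OF yb, of \<epsilon> m] by blast
    have "{k. x k \<noteq> 0} \<subseteq> A" using x(2) by auto
    then have xX: "x \<in> ?X"
      using x(1) by (intro finite_support_predual) (rule finite_subset)
    have "cmod (\<Sum>k\<in>A. x k * y k) \<le> K * predual_norm w x"
      using K[OF xX] fin[OF x(1,2)] by simp
    also have "\<dots> \<le> K * 1" using x(3) by (intro mult_left_mono) (auto simp: K_def)
    finally show "(\<Sum>i<m. dec_rearr y i * w i) \<le> K + \<epsilon>" using x(4) by simp
  qed
  then have "summable (\<lambda>n. dec_rearr y n * w n)"
    using dec_rearr_nonneg[OF yb] w_nonneg by (intro summableI_nonneg_bounded[of _ K]) auto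
  with yb have yl: "y \<in> lorentz_space w" by (simp add: lorentz_space_def)
  have "\<phi> x = (\<Sum>n. x n * y n)" if x: "x \<in> ?X" for x
  proof -
    define t where "t n = (\<lambda>k. if k < n then 0 else x k)" for n
    have tX: "t n \<in> ?X" for n
      by (rule predual_space_mono[OF x]) (simp add: t_def)
    have split: "\<phi> x - (\<Sum>k<n. x k * y k) = \<phi> (t n)" for n
    proof -
      define h where "h = (\<lambda>k. if k < n then x k else 0)"
      have hX: "h \<in> ?X" by (rule predual_space_mono[OF x]) (simp add: h_def)
      have "x = h + t n" by (auto simp: fun_eq_iff h_def t_def)
      then have "\<phi> x = \<phi> h + \<phi> (t n)" using add[OF hX tX] by simp
      moreover have "\<phi> h = (\<Sum>k<n. x k * y k)"
        using fin[of "{..<n}" h] by (simp add: h_def)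
      ultimately show ?thesis by simp
    qed
    have "(\<lambda>n. \<Sum>k<n. x k * y k) \<longlonglongrightarrow> \<phi> x"
    proof (rule LIMSEQ_I)
      fix r :: real assume "0 < r"
      define \<epsilon> where "\<epsilon> = r / (2 * (K + 1))"
      have "0 \<le> K" by (simp add: K_def)
      then have \<epsilon>: "0 < \<epsilon>" using \<open>0 < r\<close> by (simp add: \<epsilon>_def)
      obtain m where m: "\<And>n. m \<le> n \<Longrightarrow> predual_norm w (t n) \<le> \<epsilon>"
        using predual_truncation[OF x \<epsilon>] by (auto simp: t_def)
      have "norm ((\<Sum>k<n. x k * y k) - \<phi> x) < r" if "m \<le> n" for n
      proof -
        have "norm ((\<Sum>k<n. x k * y k) - \<phi> x) = cmod (\<phi> (t n))"
          using split[of n] by (metis norm_minus_commute)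
        also have "\<dots> \<le> K * predual_norm w (t n)" by (rule K[OF tX])
        also have "\<dots> \<le> K * \<epsilon>" using m[OF that] \<open>0 \<le> K\<close> by (rule mult_left_mono)
        also have "\<dots> \<le> (K + 1) * \<epsilon>" using \<epsilon> by simp
        also have "\<dots> = r / 2" using \<open>0 \<le> K\<close> by (simp add: \<epsilon>_def field_simps)
        also have "\<dots> < r" using \<open>0 < r\<close> by simp
        finally show ?thesis .
      qed
      then show "\<exists>no. \<forall>n\<ge>no. norm ((\<Sum>k<n. x k * y k) - \<phi> x) < r" by blast
    qed
    then show ?thesis using sums_unique by (auto simp: sums_def)
  qed
  with yl show ?thesis by blast
qed

end

end

theory Submission
  imports Defs "HOL-Complex_Analysis.Conformal_Mappings"
begin

text \<open>The polynomial is \<open>Q x = (\<Sum>k. x k ^ N) *\<^sub>C y0\<close> with \<open>norm y0 = 1\<close>; it is bounded because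
  \<open>d\<^sub>*(w,1)\<close> embeds into \<open>\<ell>\<^sub>N\<close>. Suppose that \<open>g\<close> attains its \<open>v\<close>-norm at \<open>x\<close> and is uniformly close
  to \<open>Q\<close>. Then \<open>x \<noteq> 0\<close>, and the norm of \<open>x\<close> stays away from \<open>1\<close>. For large \<open>n\<close>, small multiples of
  the \<open>n\<close>-th unit vector can be added to \<open>x\<close> without increasing its norm, so by the strong maximum
  principle, valid for strictly convex ranges, \<open>g\<close> is constant along the whole disc in this
  direction, whose radius \<open>\<rho>\<close> is bounded below. But \<open>Q\<close> changes by about \<open>\<rho> ^ N\<close> there, as
  \<open>x n \<longlonglongrightarrow> 0\<close>.\<close>

section \<open>The strong maximum principle for strictly convex ranges\<close>

text \<open>The radius within which a perturbation does not increase the norm of \<open>x\<close>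
  depends on \<open>x\<close>, hence on \<open>g\<close>, while the distance from \<open>Q\<close>
  to \<open>g\<close> must be fixed before \<open>g\<close> is known. Holomorphy resolves this:
  constancy on however small a disc spreads to the disc of radius
  \<open>1 - predual_norm w x\<close>, where the line stays in the open ball. That radius is bounded
  below in terms of \<open>N\<close> and \<open>w\<close> alone: the \<open>v\<close>-norm of
  \<open>g\<close> is not much smaller than the weighted value of \<open>Q\<close> at half a unit
  vector, and \<open>norm (g x)\<close> is bounded, so the weight at \<open>x\<close> cannot be
  small. The origin has to be excluded because every nonzero perturbation of it increases the norm.
  Strict convexity matters for the maximum principle: under the maximum norm, the map sending z to
  (1, z) has constant norm on the unit disc without being constant. The principle is reduced to
  scalar functions by functionals norming a given vector, which come from a minimal sublinear
  functional.\<close>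

definition sublinear :: "('a::real_vector \<Rightarrow> real) \<Rightarrow> bool"
  where "sublinear p \<longleftrightarrow>
    (\<forall>x y. p (x + y) \<le> p x + p y) \<and> (\<forall>t>0. \<forall>x. p (t *\<^sub>R x) \<le> t * p x)"

lemma sublinear_0: "sublinear p \<Longrightarrow> p 0 = 0"
proof -
  assume "sublinear p"
  \<comment> \<open>The factor 1/2 gives \<open>p 0 \<le> 0\<close>, the factor 2 the reverse
    inequality.\<close>
  then have "p ((1/2) *\<^sub>R 0) \<le> 1/2 * p 0" "p (2 *\<^sub>R 0) \<le> 2 * p 0"
    unfolding sublinear_def by (simp_all only: zero_less_numeral zero_less_divide_1_iff)
  then show ?thesis by simp
qed

lemma sublinear_minus:
  assumes "sublinear p"
  shows "- p (- x) \<le> p x"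
proof -
  have "p (x + - x) \<le> p x + p (- x)" using assms unfolding sublinear_def by blast
  then show ?thesis using sublinear_0[OF assms] by simp
qed

text \<open>The inequalities for \<open>t\<close> and for its inverse combine to an equality.
  Demanding only an inequality in \<open>sublinear\<close> leaves less to verify for the infima
  taken below.\<close>

lemma sublinear_scale:
  assumes "sublinear p" "0 \<le> t"
  shows "p (t *\<^sub>R x) = t * p x"
proof (cases "t = 0")
  case False
  then have t: "0 < t" using assms(2) by simp
  have "p (inverse t *\<^sub>R (t *\<^sub>R x)) \<le> inverse t * p (t *\<^sub>R x)"
    using assms(1) t unfolding sublinear_def by (meson positive_imp_inverse_positive)
  then have "t * p x \<le> p (t *\<^sub>R x)"
    using t by (simp add: field_simps)
  moreover have "p (t *\<^sub>R x) \<le> t * p x"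
    using assms(1) t unfolding sublinear_def by blast
  ultimately show ?thesis by simp
qed (simp add: sublinear_0[OF assms(1)])

text \<open>The lowering step in the proof of Hahn-Banach through minimal sublinear functionals. The
  infimum over \<open>t\<close> is finite because subadditivity bounds it below by
  \<open>- p (- x)\<close>; \<open>t = 0\<close> and \<open>t = 1\<close> give the two upper bounds.
  For \<open>x = - a\<close> the second one reads \<open>q (- a) \<le> - p a\<close>.\<close>

lemma sublinear_shift:
  assumes p: "sublinear p"
  shows "\<exists>q. sublinear q \<and> (\<forall>x. q x \<le> p x) \<and> (\<forall>x. q x \<le> p (x + a) - p a)"
proof -
  define q where "q x = (INF t\<in>{0..}. p (x + t *\<^sub>R a) - t * p a)" for x
  have add: "p (x + y) \<le> p x + p y" for x y
    using p by (simp add: sublinear_def)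
  have bdd: "bdd_below ((\<lambda>t. p (x + t *\<^sub>R a) - t * p a) ` {0..})" for x
  proof (rule bdd_belowI2[where m = "- p (- x)"])
    fix t :: real assume "t \<in> {0..}"
    then have "t * p a = p ((x + t *\<^sub>R a) + (- x))"
      by (simp add: sublinear_scale[OF p])
    then show "- p (- x) \<le> p (x + t *\<^sub>R a) - t * p a"
      using add[of "x + t *\<^sub>R a" "- x"] by linarith
  qed
  have le: "q x \<le> p (x + t *\<^sub>R a) - t * p a" if "0 \<le> t" for x t
    unfolding q_def using that by (intro cINF_lower[OF bdd]) auto
  have gr: "m \<le> q x" if "\<And>t. 0 \<le> t \<Longrightarrow> m \<le> p (x + t *\<^sub>R a) - t * p a" for m x
    unfolding q_def using that by (intro cINF_greatest) auto
  have "sublinear q"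
    unfolding sublinear_def
  proof (intro conjI allI impI)
    fix x y
    have "q (x + y) - (p (y + t *\<^sub>R a) - t * p a) \<le> p (x + s *\<^sub>R a) - s * p a"
      if "0 \<le> s" "0 \<le> t" for s t
      using le[of "s + t" "x + y"] add[of "x + s *\<^sub>R a" "y + t *\<^sub>R a"] that
      by (simp add: algebra_simps)
    then have "q (x + y) - (p (y + t *\<^sub>R a) - t * p a) \<le> q x" if "0 \<le> t" for t
      using that by (intro gr) auto
    then have "q (x + y) - q x \<le> q y"
      by (intro gr) (simp add: algebra_simps)
    then show "q (x + y) \<le> q x + q y" by simp
  next
    fix t :: real and x assume t: "0 < t"
    have "q (t *\<^sub>R x) / t \<le> p (x + s *\<^sub>R a) - s * p a" if "0 \<le> s" for s
    proof -
      have "q (t *\<^sub>R x) \<le> p (t *\<^sub>R (x + s *\<^sub>R a)) - (t * s) * p a"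
        using le[of "t * s" "t *\<^sub>R x"] that t by (simp add: scaleR_add_right)
      also have "\<dots> = t * (p (x + s *\<^sub>R a) - s * p a)"
        using t by (simp only: sublinear_scale[OF p] less_imp_le) (simp add: right_diff_distrib)
      finally show ?thesis using t by (simp add: field_simps)
    qed
    then have "q (t *\<^sub>R x) / t \<le> q x" by (rule gr)
    then show "q (t *\<^sub>R x) \<le> t * q x" using t by (simp add: field_simps)
  qed
  then show ?thesis
    using le[of 0] le[of 1] by (intro exI[of _ q]) auto
qed

text \<open>A minimal sublinear functional is additive, because \<open>sublinear_shift\<close> cannot lower it.\<close>

lemma real_norming_functional:
  fixes y :: "'a::real_normed_vector"
  shows "\<exists>p. (\<forall>u v. p (u + v) = p u + p v) \<and> (\<forall>c u. p (c *\<^sub>R u) = c * p u) \<and>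
    (\<forall>u. p u \<le> norm u) \<and> p y = norm y"
proof -
  have "sublinear (norm :: 'a \<Rightarrow> real)"
    by (simp add: sublinear_def norm_triangle_ineq)
  \<comment> \<open>Minimising below this \<open>q\<close> instead of the norm decides the value at
    \<open>y\<close>: since \<open>q (- y) \<le> - norm y\<close>, an additive \<open>p\<close>
    below \<open>q\<close> has \<open>norm y \<le> p y\<close>.\<close>
  from sublinear_shift[OF this, of y] obtain q where q: "sublinear q"
      "\<And>x. q x \<le> norm x" "\<And>x. q x \<le> norm (x + y) - norm y"
    by blast
  define S where "S = {p. sublinear p \<and> (\<forall>x. p x \<le> q x)}"
  let ?R = "relation_of (\<lambda>p r. r \<le> p) S"
  have "\<exists>m\<in>S. \<forall>p\<in>S. p \<le> m \<longrightarrow> p = m"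
  proof (rule predicate_Zorn)
    show "partial_order_on S ?R"
      by (auto simp: partial_order_on_def preorder_on_def refl_on_def trans_def antisym_def
          relation_of_def)
  next
    fix C assume "C \<in> Chains ?R"
    then have C: "C \<subseteq> S" "\<And>p r. p \<in> C \<Longrightarrow> r \<in> C \<Longrightarrow> p \<le> r \<or> r \<le> p"
      by (auto simp: Chains_def relation_of_def)
    show "\<exists>u\<in>S. \<forall>p\<in>C. u \<le> p"
    proof (cases "C = {}")
      case True
      then show ?thesis using q(1) by (auto simp: S_def)
    next
      case False
      have sub: "sublinear p" "p x \<le> q x" if "p \<in> C" for p x
        using C(1) that by (auto simp: S_def)
      define u where "u x = (INF p\<in>C. p x)" for x
      have bdd: "bdd_below ((\<lambda>p. p x) ` C)" for x
      proof (rule bdd_belowI2[where m = "- q (- x)"])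
        fix p assume p: "p \<in> C"
        show "- q (- x) \<le> p x"
          using sublinear_minus[OF sub(1)[OF p], of x] sub(2)[OF p, of "- x"] by linarith
      qed
      have le: "u x \<le> p x" if "p \<in> C" for p x
        unfolding u_def by (rule cINF_lower[OF bdd that])
      have gr: "m \<le> u x" if "\<And>p. p \<in> C \<Longrightarrow> m \<le> p x" for m x
        unfolding u_def using False that by (rule cINF_greatest)
      have "sublinear u"
        unfolding sublinear_def
      proof (intro conjI allI impI)
        fix x y
        have "u (x + y) - r y \<le> p x" if pr: "p \<in> C" "r \<in> C" for p r
        proof -
          \<comment> \<open>The chain provides a common lower bound of \<open>p\<close> and
            \<open>r\<close>; an infimum over an arbitrary set of sublinear functionals need not be
            subadditive.\<close>
          obtain s where s: "s \<in> C" "s \<le> p" "s \<le> r" using C(2)[OF pr] pr by blast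
          have "u (x + y) \<le> s (x + y)" by (rule le[OF s(1)])
          also have "\<dots> \<le> s x + s y" using sub(1)[OF s(1)] by (simp add: sublinear_def)
          also have "\<dots> \<le> p x + r y" using s(2,3) by (intro add_mono) (auto simp: le_fun_def)
          finally show ?thesis by simp
        qed
        then have "u (x + y) - r y \<le> u x" if "r \<in> C" for r
          using that by (intro gr) auto
        then have "u (x + y) - u x \<le> u y"
          by (intro gr) (simp add: algebra_simps)
        then show "u (x + y) \<le> u x + u y" by simp
      next
        fix t :: real and x assume t: "0 < t"
        have "u (t *\<^sub>R x) / t \<le> u x"
        proof (rule gr)
          fix p assume p: "p \<in> C"
          have "u (t *\<^sub>R x) \<le> t * p x"
            using le[OF p, of "t *\<^sub>R x"] sublinear_scale[OF sub(1)[OF p], of t x] t by simp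
          then show "u (t *\<^sub>R x) / t \<le> p x" using t by (simp add: field_simps)
        qed
        then show "u (t *\<^sub>R x) \<le> t * u x" using t by (simp add: field_simps)
      qed
      moreover have "u x \<le> q x" for x
        using False le sub(2) order_trans by blast
      ultimately show ?thesis
        using le by (intro bexI[of _ u]) (auto simp: S_def le_fun_def)
    qed
  qed
  then obtain p where "p \<in> S" and minS: "\<And>r. r \<in> S \<Longrightarrow> r \<le> p \<Longrightarrow> r = p"
    by blast
  then have p: "sublinear p" "\<And>x. p x \<le> q x" by (auto simp: S_def)
  have min: "r = p" if "sublinear r" "\<And>x. r x \<le> p x" for r
    using that order_trans[OF that(2) p(2)] by (intro minS) (auto simp: S_def le_fun_def)
  have add: "p (u + v) = p u + p v" for u v
  proof -
    obtain r where r: "sublinear r" "\<And>x. r x \<le> p x" "\<And>x. r x \<le> p (x + v) - p v"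
      using sublinear_shift[OF p(1)] by blast
    have "p u \<le> p (u + v) - p v" using min[OF r(1,2)] r(3) by metis
    moreover have "p (u + v) \<le> p u + p v" using p(1) by (simp add: sublinear_def)
    ultimately show ?thesis by simp
  qed
  have neg: "p (- u) = - p u" for u
    using add[of u "- u"] sublinear_0[OF p(1)] by simp
  have "p (c *\<^sub>R u) = c * p u" for c u
    using sublinear_scale[OF p(1), of c u] sublinear_scale[OF p(1), of "- c" u] neg[of "c *\<^sub>R u"]
    by (cases "0 \<le> c") auto
  moreover have le: "p u \<le> norm u" for u
    using p(2) q(2) order_trans by blast
  moreover have "p y = norm y"
    using le[of y] p(2)[of "- y"] q(3)[of "- y"] neg[of y] by simp
  ultimately show ?thesis using add by blast
qed

text \<open>A complex linear functional is determined by its real part; taking \<open>p\<close> as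
  real part dictates the imaginary part. The modulus bound follows by rotating
  \<open>\<phi> u\<close> onto the nonnegative axis, where only \<open>p\<close> is seen.\<close>

lemma norming_functional:
  fixes y :: "'a::complex_normed_vector"
  shows "\<exists>\<phi> :: 'a \<Rightarrow> complex. (\<forall>u v. \<phi> (u + v) = \<phi> u + \<phi> v) \<and> (\<forall>c u. \<phi> (c *\<^sub>C u) = c * \<phi> u) \<and>
    (\<forall>u. cmod (\<phi> u) \<le> norm u) \<and> \<phi> y = of_real (norm y)"
proof -
  obtain p where add: "\<And>u v. p (u + v) = p u + p v" and scale: "\<And>c u. p (c *\<^sub>R u) = c * p u"
    and le: "\<And>u. p u \<le> norm u" and y: "p y = norm y"
    using real_norming_functional[of y] by blast
  have neg: "p (- u) = - p u" for u using scale[of "-1" u] by simp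
  define \<phi> where "\<phi> u = Complex (p u) (- p (\<i> *\<^sub>C u))" for u
  have \<phi>_add: "\<phi> (u + v) = \<phi> u + \<phi> v" for u v
    by (simp add: \<phi>_def complex_eq_iff add scaleC_add_right)
  have \<phi>_real: "\<phi> (of_real c *\<^sub>C u) = of_real c * \<phi> u" for c u
    using scale[of c "\<i> *\<^sub>C u"] scale[of c u]
    by (simp add: \<phi>_def complex_eq_iff scaleR_scaleC scaleC_scaleC mult.commute)
  have \<phi>_i: "\<phi> (\<i> *\<^sub>C u) = \<i> * \<phi> u" for u
  proof -
    have "(-1) *\<^sub>C u = - u"
      using scaleR_scaleC[of "-1" u] by simp
    then show ?thesis
      by (simp add: \<phi>_def complex_eq_iff scaleC_scaleC neg)
  qed
  have \<phi>_scale: "\<phi> (c *\<^sub>C u) = c * \<phi> u" for c u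
  proof -
    have "c *\<^sub>C u = of_real (Re c) *\<^sub>C u + of_real (Im c) *\<^sub>C \<i> *\<^sub>C u"
      by (simp add: scaleC_scaleC mult.commute flip: scaleC_add_left complex_eq)
    then have "\<phi> (c *\<^sub>C u) = (of_real (Re c) + of_real (Im c) * \<i>) * \<phi> u"
      by (simp add: \<phi>_add \<phi>_real \<phi>_i algebra_simps)
    also have "of_real (Re c) + of_real (Im c) * \<i> = c"
      by (simp add: complex_eq_iff)
    finally show ?thesis .
  qed
  have \<phi>_le: "cmod (\<phi> u) \<le> norm u" for u
  proof -
    let ?c = "cnj (sgn (\<phi> u))"
    have "?c * \<phi> u = of_real (cmod (\<phi> u))"
    proof (cases "\<phi> u = 0")
      case False
      have "?c * \<phi> u = (\<phi> u * cnj (\<phi> u)) / of_real (cmod (\<phi> u))"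
        by (simp add: sgn_eq mult.commute)
      also have "\<dots> = of_real (cmod (\<phi> u))"
        using False by (simp add: complex_norm_square[symmetric] power2_eq_square)
      finally show ?thesis .
    qed simp
    then have "cmod (\<phi> u) = Re (\<phi> (?c *\<^sub>C u))"
      by (simp add: \<phi>_scale)
    also have "\<dots> \<le> norm (?c *\<^sub>C u)" using le by (simp add: \<phi>_def)
    also have "\<dots> \<le> 1 * norm u"
      unfolding norm_scaleC by (intro mult_right_mono) (auto simp: norm_sgn)
    finally show ?thesis by simp
  qed
  have "\<phi> y = of_real (norm y)"
  proof -
    \<comment> \<open>The real part already exhausts the bound \<open>norm y\<close> on the modulus,
      which forces the imaginary part to vanish.\<close>
    have "(Re (\<phi> y))\<^sup>2 + (Im (\<phi> y))\<^sup>2 \<le> (norm y)\<^sup>2"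
      using \<phi>_le[of y] by (simp add: cmod_power2[symmetric])
    moreover have "Re (\<phi> y) = norm y" by (simp add: \<phi>_def y)
    ultimately show ?thesis by (simp add: complex_eq_iff)
  qed
  with \<phi>_add \<phi>_scale \<phi>_le show ?thesis by blast
qed

text \<open>The hypotheses force equal norms, so dividing by the common norm leads back to the unit
  sphere, where strict convexity is stated. The one-sided assumption is what a maximum of the norm
  at \<open>v\<close> provides.\<close>

lemma strictly_convex_midpoint:
  fixes u v :: "'a::complex_normed_vector"
  assumes "strictly_convex TYPE('a)" and "norm u \<le> norm v" "2 * norm v \<le> norm (u + v)"
  shows "u = v"
proof (rule ccontr)
  assume "u \<noteq> v"
  then have pos: "0 < norm v" using assms(2) by auto
  have eq: "norm u = norm v" using assms(2,3) norm_triangle_ineq[of u v] by simp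
  let ?c = "inverse (norm v)"
  have "norm (?c *\<^sub>R u) = 1" "norm (?c *\<^sub>R v) = 1" "?c *\<^sub>R u \<noteq> ?c *\<^sub>R v"
    using pos eq \<open>u \<noteq> v\<close> by auto
  then have "norm ((1/2) *\<^sub>R (?c *\<^sub>R u + ?c *\<^sub>R v)) < 1"
    using assms(1) unfolding strictly_convex_def by blast
  also have "(1/2) *\<^sub>R (?c *\<^sub>R u + ?c *\<^sub>R v) = (?c / 2) *\<^sub>R (u + v)"
    by (simp add: scaleR_add_right)
  finally have "norm (u + v) < 2 * norm v"
    using pos by (simp add: divide_less_eq inverse_eq_divide)
  with assms(3) show False by simp
qed

text \<open>Holomorphy is asked only of compositions with functionals, so no derivative of a
  vector-valued function is involved. On the small disc a functional norming \<open>F 0\<close> has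
  maximal modulus at 0, hence is constant along \<open>F\<close>; the midpoint of \<open>F z\<close>
  and \<open>F 0\<close> then has full norm and strict convexity identifies them. Farther out no
  bound on \<open>norm (F z)\<close> is known, but every composition is constant near 0, and the
  scalar maximum modulus principle compares values on the small disc only while concluding on all of
  \<open>ball 0 R\<close>.\<close>

lemma strong_maximum_principle:
  fixes F :: "complex \<Rightarrow> 'a::complex_normed_vector"
  assumes sc: "strictly_convex TYPE('a)"
    and hol: "\<And>\<phi> :: 'a \<Rightarrow> complex. (\<And>u v. \<phi> (u + v) = \<phi> u + \<phi> v) \<Longrightarrow> (\<And>c u. \<phi> (c *\<^sub>C u) = c * \<phi> u) \<Longrightarrow>
      (\<And>u. cmod (\<phi> u) \<le> norm u) \<Longrightarrow> (\<lambda>z. \<phi> (F z)) holomorphic_on ball 0 R"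
    and "0 < \<delta>" "\<delta> \<le> R" and max: "\<And>z. cmod z < \<delta> \<Longrightarrow> norm (F z) \<le> norm (F 0)"
    and z: "cmod z < R"
  shows "F z = F 0"
proof -
  have const: "\<phi> (F z) = \<phi> (F 0)"
    if \<phi>: "\<And>u v. \<phi> (u + v) = \<phi> u + \<phi> v" "\<And>c u. \<phi> (c *\<^sub>C u) = c * \<phi> u"
      "\<And>u. cmod (\<phi> u) \<le> norm u"
      and "\<And>z. cmod z < \<delta> \<Longrightarrow> cmod (\<phi> (F z)) \<le> cmod (\<phi> (F 0))" "cmod z < R"
    for \<phi> :: "'a \<Rightarrow> complex" and z
  proof -
    have "(\<lambda>z. \<phi> (F z)) constant_on ball 0 R"
      by (rule maximum_modulus_principle[OF hol[OF \<phi>], where U = "ball 0 \<delta>" and \<xi> = 0])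
         (use that assms(3,4) in auto)
    then show ?thesis
      using that(5) \<open>0 < \<delta>\<close> \<open>\<delta> \<le> R\<close> by (auto simp: constant_on_def)
  qed
  have near: "F z = F 0" if "cmod z < \<delta>" for z
  proof -
    obtain \<phi> :: "'a \<Rightarrow> complex" where \<phi>: "\<And>u v. \<phi> (u + v) = \<phi> u + \<phi> v" "\<And>c u. \<phi> (c *\<^sub>C u) = c * \<phi> u"
      "\<And>u. cmod (\<phi> u) \<le> norm u" "\<phi> (F 0) = of_real (norm (F 0))"
      using norming_functional[of "F 0"] by blast
    have "\<phi> (F z) = of_real (norm (F 0))"
      unfolding \<phi>(4)[symmetric]
    proof (rule const[OF \<phi>(1-3)])
      fix x assume "cmod x < \<delta>"
      then show "cmod (\<phi> (F x)) \<le> cmod (\<phi> (F 0))"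
        using order_trans[OF \<phi>(3) max] by (simp add: \<phi>(4))
    qed (use that \<open>\<delta> \<le> R\<close> in simp)
    then have "\<phi> (F z + F 0) = of_real (2 * norm (F 0))"
      by (simp add: \<phi>)
    then have "2 * norm (F 0) \<le> norm (F z + F 0)"
      using \<phi>(3)[of "F z + F 0"] by simp
    then show ?thesis by (rule strictly_convex_midpoint[OF sc max[OF that]])
  qed
  \<comment> \<open>This functional is chosen after \<open>z\<close>, in order to separate
    \<open>F z\<close> from \<open>F 0\<close>.\<close>
  obtain \<phi> :: "'a \<Rightarrow> complex" where \<phi>: "\<And>u v. \<phi> (u + v) = \<phi> u + \<phi> v" "\<And>c u. \<phi> (c *\<^sub>C u) = c * \<phi> u"
    "\<And>u. cmod (\<phi> u) \<le> norm u" "\<phi> (F z - F 0) = of_real (norm (F z - F 0))"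
    using norming_functional[of "F z - F 0"] by blast
  have "\<phi> (F z) = \<phi> (F 0)"
    by (rule const[OF \<phi>(1-3) _ z]) (simp add: near)
  moreover have "\<phi> (F z) = \<phi> (F z - F 0) + \<phi> (F 0)"
    using \<phi>(1)[of "F z - F 0" "F 0"] by simp
  ultimately show ?thesis using \<phi>(4) by simp
qed

section \<open>The norm of \<open>d\<^sub>*(w,1)\<close>\<close>

text \<open>A converse of \<open>sum_le_sum_dec_rearr\<close>: norm bounds reduce to sums over
  finite index sets, so a perturbed sequence need not be rearranged. The selected moduli reach the
  rearranged values only up to \<eta>, whose denominator \<open>m + 1\<close> covers
  \<open>m = 0\<close>.\<close>

lemma sum_dec_rearr_leI:
  assumes "\<And>G. finite G \<Longrightarrow> card G = m \<Longrightarrow> (\<Sum>k\<in>G. cmod (x k)) \<le> B"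
  shows "(\<Sum>i<m. dec_rearr x i) \<le> B"
proof (rule field_le_epsilon)
  fix \<epsilon> :: real assume "0 < \<epsilon>"
  define \<eta> where "\<eta> = \<epsilon> / (real m + 1)"
  have \<eta>: "0 < \<eta>" using \<open>0 < \<epsilon>\<close> by (simp add: \<eta>_def)
  obtain a where a: "inj_on a {..<m}" "\<And>i. i < m \<Longrightarrow> dec_rearr x i - \<eta> < cmod (x (a i))"
    using dec_rearr_selection[OF \<eta>, of m x] by blast
  have "(\<Sum>i<m. dec_rearr x i) \<le> (\<Sum>i<m. cmod (x (a i)) + \<eta>)"
    using a(2) by (intro sum_mono) (auto simp: diff_less_eq intro: less_imp_le)
  also have "\<dots> = (\<Sum>k\<in>a ` {..<m}. cmod (x k)) + real m * \<eta>"
    using a(1) by (simp add: sum.distrib sum.reindex)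
  also have "(\<Sum>k\<in>a ` {..<m}. cmod (x k)) \<le> B"
    using a(1) by (intro assms) (simp_all add: card_image)
  also have "real m * \<eta> \<le> \<epsilon>"
    using \<open>0 < \<epsilon>\<close> by (simp add: \<eta>_def field_simps)
  finally show "(\<Sum>i<m. dec_rearr x i) \<le> B + \<epsilon>" by simp
qed

definition unit_seq :: "nat \<Rightarrow> nat \<Rightarrow> complex"
  where "unit_seq n = (\<lambda>k. if k = n then 1 else 0)"

section \<open>Finite index sets, unit vectors and small perturbations\<close>

context
  fixes w :: "nat \<Rightarrow> real"
  assumes adm: "admissible w" and nsum: "\<not> summable w"
begin

lemma sum_le_predual_norm:
  assumes "x \<in> predual_space w" "finite G"
  shows "(\<Sum>k\<in>G. cmod (x k)) \<le> predual_norm w x * (\<Sum>i<card G. w i)"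
proof -
  \<comment> \<open>Any enumeration will do; the constant key makes the monotonicity clause
    trivial.\<close>
  obtain a where a: "bij_betw a {..<card G} G"
    using decreasing_enumeration[OF assms(2) refl, of "\<lambda>_. 0"] by blast
  have "(\<Sum>k\<in>G. cmod (x k)) = (\<Sum>i<card G. cmod (x (a i)))"
    by (rule sum.reindex_bij_betw[OF a, symmetric])
  also have "\<dots> \<le> (\<Sum>i<card G. dec_rearr x i)"
    using a predual_bounded[OF adm nsum assms(1)]
    by (intro sum_le_sum_dec_rearr) (auto simp: bij_betw_def)
  also have "\<dots> \<le> predual_norm w x * (\<Sum>i<card G. w i)"
    by (rule sum_dec_rearr_le_norm[OF adm nsum assms(1)])
  finally show ?thesis .
qed

lemma predual_space_diff:
  assumes "x \<in> predual_space w" "y \<in> predual_space w"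
  shows "x - y \<in> predual_space w"
proof -
  have "x - y = x + (-1) *\<^sub>C y"
    by (simp add: fun_eq_iff scaleC_fun_def scaleC_complex_def)
  then show ?thesis
    using predual_space_add(1)[OF adm nsum assms(1)] predual_space_scaleC(1)[OF adm nsum assms(2)]
    by metis
qed

lemma zero_predual: "0 \<in> predual_space w" "predual_norm w 0 = 0"
proof -
  show "0 \<in> predual_space w" by (rule finite_support_predual[OF adm nsum]) simp
  from predual_space_scaleC(2)[OF adm nsum this, of 0] show "predual_norm w 0 = 0"
    by (simp add: scaleC_fun_def scaleC_complex_def zero_fun_def)
qed

lemma predual_norm_pos: "x \<in> predual_space w \<Longrightarrow> x \<noteq> 0 \<Longrightarrow> 0 < predual_norm w x"
  using predual_norm_eq_0D[OF adm nsum] predual_norm_nonneg[OF adm nsum] by fastforce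

lemma predual_tendsto_0:
  assumes "x \<in> predual_space w"
  shows "x \<longlonglongrightarrow> 0"
proof (rule LIMSEQ_I)
  fix r :: real assume "0 < r"
  then have "finite {k. r / 2 < cmod (x k)}"
    using predual_null_sequence[OF adm nsum assms, of "r / 2"] by simp
  then obtain m where m: "\<And>k. r / 2 < cmod (x k) \<Longrightarrow> k < m"
    by (metis finite_nat_set_iff_bounded mem_Collect_eq)
  have "norm (x n - 0) < r" if "m \<le> n" for n
    using m[of n] that \<open>0 < r\<close> by fastforce
  then show "\<exists>no. \<forall>n\<ge>no. norm (x n - 0) < r" by blast
qed

lemma unit_seq_predual: "unit_seq n \<in> predual_space w"
  by (rule finite_support_predual[OF adm nsum]) (simp add: unit_seq_def)

lemma predual_norm_unit_seq: "predual_norm w (unit_seq n) \<le> 1"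
proof (rule predual_norm_le[OF adm nsum])
  fix m
  have "(\<Sum>k<Suc m. dec_rearr (unit_seq n) k) \<le> 1"
  proof (rule sum_dec_rearr_leI)
    fix G :: "nat set" assume "finite G"
    then show "(\<Sum>k\<in>G. cmod (unit_seq n k)) \<le> 1"
      by (simp add: unit_seq_def if_distrib[of cmod] cong: if_cong)
  qed
  then show "(\<Sum>k\<le>m. dec_rearr (unit_seq n) k) \<le> 1 * (\<Sum>k\<le>m. w k)"
    using W_ge_1[OF adm nsum, of m] by (simp add: lessThan_Suc_atMost)
qed

lemma predual_norm_scaled_unit_seq: "predual_norm w (c *\<^sub>C unit_seq n) \<le> cmod c"
  using mult_left_mono[OF predual_norm_unit_seq[of n], of "cmod c"]
  by (simp add: predual_space_scaleC(2)[OF adm nsum unit_seq_predual])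

text \<open>For \<open>j \<ge> J\<close> the means of \<open>x\<close> are below half of the norm. For \<open>j < J\<close> a sum of \<open>j + 1\<close> moduli
  that involves the modified term of size at most \<open>r * w J\<close> has only \<open>j\<close> further terms, whose sum
  is at most \<open>r * (\<Sum>i<j. w i)\<close>.\<close>

lemma predual_norm_perturbation:
  assumes x: "x \<in> predual_space w" and "x \<noteq> 0"
  shows "\<exists>\<delta>>0. \<exists>m. \<forall>n\<ge>m. \<forall>c. cmod c \<le> \<delta> \<longrightarrow>
    predual_norm w (x + c *\<^sub>C unit_seq n) \<le> predual_norm w x"
proof -
  define r where "r = predual_norm w x"
  have r: "0 < r" unfolding r_def by (rule predual_norm_pos[OF assms])
  have "eventually (\<lambda>n. predual_mean w x n < r / 2) sequentially"
    using x r by (intro order_tendstoD[of _ 0]) (auto simp: predual_space_def)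
  then obtain J where J: "\<And>n. J \<le> n \<Longrightarrow> predual_mean w x n < r / 2"
    by (auto simp: eventually_sequentially)
  \<comment> \<open>The modified entry has modulus at most \<open>2 * \<delta> = r * w J\<close>,
    hence at most \<open>r * w j\<close> for \<open>j < J\<close>. As \<open>w J \<le> 1\<close>,
    also \<open>\<delta> \<le> r / 2\<close>, the slack left by the means with
    \<open>J \<le> j\<close>.\<close>
  define \<delta> where "\<delta> = r * w J / 2"
  have \<delta>: "0 < \<delta>" "\<delta> \<le> r / 2"
    using r w_pos[OF adm nsum, of J] w_le_1[OF adm nsum, of J] by (auto simp: \<delta>_def)
  obtain m where m: "\<And>n. m \<le> n \<Longrightarrow> cmod (x n) < \<delta>"
    using LIMSEQ_D[OF predual_tendsto_0[OF x] \<delta>(1)] by auto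
  have "predual_norm w (x + c *\<^sub>C unit_seq n) \<le> r" if n: "m \<le> n" and c: "cmod c \<le> \<delta>" for n c
  proof (rule predual_norm_le[OF adm nsum])
    fix j
    let ?z = "x + c *\<^sub>C unit_seq n"
    note u = predual_space_scaleC(1)[OF adm nsum unit_seq_predual[of n], of c]
    have zk: "(c *\<^sub>C unit_seq n) k = (if k = n then c else 0)" for k
      by (simp add: scaleC_fun_def scaleC_complex_def unit_seq_def)
    have "(\<Sum>k<Suc j. dec_rearr ?z k) \<le> r * (\<Sum>k<Suc j. w k)"
    proof (cases "J \<le> j")
      case True
      have "(\<Sum>k<Suc j. dec_rearr ?z k)
          \<le> (\<Sum>k<Suc j. dec_rearr x k) + (\<Sum>k<Suc j. dec_rearr (c *\<^sub>C unit_seq n) k)"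
        by (intro sum_dec_rearr_add_le predual_bounded[OF adm nsum] x u)
      also have "\<dots> \<le> r / 2 * (\<Sum>k<Suc j. w k) + \<delta> * (\<Sum>k<Suc j. w k)"
      proof (rule add_mono)
        show "(\<Sum>k<Suc j. dec_rearr x k) \<le> r / 2 * (\<Sum>k<Suc j. w k)"
          using J[OF True] W_pos[OF adm nsum, of j]
          by (simp only: predual_mean_def pos_divide_less_eq lessThan_Suc_atMost less_imp_le)
        have "predual_norm w (c *\<^sub>C unit_seq n) \<le> \<delta>"
          using predual_norm_scaled_unit_seq[of c n] c by simp
        then have "predual_norm w (c *\<^sub>C unit_seq n) * (\<Sum>k<Suc j. w k) \<le> \<delta> * (\<Sum>k<Suc j. w k)"
          by (intro mult_right_mono sum_nonneg w_nonneg[OF adm nsum])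
        with sum_dec_rearr_le_norm[OF adm nsum u, of "Suc j"]
        show "(\<Sum>k<Suc j. dec_rearr (c *\<^sub>C unit_seq n) k) \<le> \<delta> * (\<Sum>k<Suc j. w k)"
          by (rule order_trans)
      qed
      also have "\<dots> \<le> r / 2 * (\<Sum>k<Suc j. w k) + r / 2 * (\<Sum>k<Suc j. w k)"
        using \<delta>(2) by (intro add_mono mult_right_mono sum_nonneg w_nonneg[OF adm nsum]) auto
      finally show ?thesis by simp
    next
      case False
      show ?thesis
      proof (rule sum_dec_rearr_leI)
        fix G :: "nat set" assume G: "finite G" "card G = Suc j"
        show "(\<Sum>k\<in>G. cmod (?z k)) \<le> r * (\<Sum>k<Suc j. w k)"
        proof (cases "n \<in> G")
          case False
          then have "(\<Sum>k\<in>G. cmod (?z k)) = (\<Sum>k\<in>G. cmod (x k))"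
            by (intro sum.cong refl) (auto simp: zk)
          then show ?thesis
            using sum_le_predual_norm[OF x G(1)] by (simp only: G(2) r_def)
        next
          case True
          have "(\<Sum>k\<in>G. cmod (?z k)) = cmod (x n + c) + (\<Sum>k\<in>G - {n}. cmod (x k))"
            by (subst sum.remove[OF G(1) True]) (auto simp: zk intro!: sum.cong)
          also have "cmod (x n + c) \<le> 2 * \<delta>"
            using norm_triangle_ineq[of "x n" c] m[OF n] c by simp
          also have "2 * \<delta> \<le> r * w j"
            using decseqD[OF w_dec[OF adm nsum], of j J] \<open>\<not> J \<le> j\<close> r by (simp add: \<delta>_def)
          also have "(\<Sum>k\<in>G - {n}. cmod (x k)) \<le> r * (\<Sum>k<j. w k)"
            using sum_le_predual_norm[OF x, of "G - {n}"] G True by (simp add: r_def)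
          finally show ?thesis by (simp add: algebra_simps)
        qed
      qed
    qed
    then show "(\<Sum>k\<le>j. dec_rearr ?z k) \<le> r * (\<Sum>k\<le>j. w k)"
      by (simp only: lessThan_Suc_atMost)
  qed
  then show ?thesis using \<delta>(1) unfolding r_def by blast
qed

text \<open>In decreasing order the moduli \<open>c i\<close> need not lie below
  \<open>?r * w i\<close>; only partial sums are comparable. Abel summation still allows replacing
  one factor \<open>c i\<close> by \<open>?r * w i\<close> as long as the remaining factors
  decrease, and the induction on \<open>j\<close> does this \<open>N\<close> times.\<close>

lemma sum_power_le:
  assumes x: "x \<in> predual_space w"
  shows "(\<Sum>k<m. cmod (x k) ^ N) \<le> predual_norm w x ^ N * (\<Sum>i<m. w i ^ N)"
proof -
  let ?r = "predual_norm w x"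
  obtain a where a: "bij_betw a {..<m} {..<m}"
    and dec: "\<And>i j. i \<le> j \<Longrightarrow> j < m \<Longrightarrow> cmod (x (a j)) \<le> cmod (x (a i))"
    using decreasing_enumeration[of "{..<m}" m "\<lambda>k. cmod (x k)"] by auto
  define c where "c i = cmod (x (a i))" for i
  have part: "(\<Sum>i<n. c i) \<le> (\<Sum>i<n. ?r * w i)" if "n \<le> m" for n
  proof -
    have inj: "inj_on a {..<n}"
      using a that by (auto simp: bij_betw_def intro: inj_on_subset)
    then have "(\<Sum>i<n. c i) = (\<Sum>k\<in>a ` {..<n}. cmod (x k))"
      by (simp add: sum.reindex c_def)
    also have "\<dots> \<le> ?r * (\<Sum>i<n. w i)"
      using sum_le_predual_norm[OF x, of "a ` {..<n}"] inj by (simp add: card_image)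
    finally show ?thesis by (simp add: sum_distrib_left)
  qed
  have "(\<Sum>i<m. c i ^ N) \<le> ?r ^ j * (\<Sum>i<m. w i ^ j * c i ^ (N - j))" if "j \<le> N" for j
    using that
  proof (induction j)
    case (Suc j)
    let ?b = "\<lambda>i. w i ^ j * c i ^ (N - Suc j)"
    have e: "N - j = Suc (N - Suc j)" using Suc.prems by simp
    have "(\<Sum>i<m. w i ^ j * c i ^ (N - j)) = (\<Sum>i<m. c i * ?b i)"
      unfolding e by (simp add: mult_ac)
    also have "\<dots> \<le> (\<Sum>i<m. (?r * w i) * ?b i)"
    proof (rule abel_sum_mono)
      show "?b k \<le> ?b i" if "i \<le> k" "k < m" for i k
        using that decseqD[OF w_dec[OF adm nsum]] dec w_nonneg[OF adm nsum]
        by (intro mult_mono power_mono) (auto simp: c_def)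
    qed (use part w_nonneg[OF adm nsum] in \<open>auto simp: c_def\<close>)
    also have "\<dots> = ?r * (\<Sum>i<m. w i ^ Suc j * c i ^ (N - Suc j))"
      by (simp add: sum_distrib_left mult_ac)
    finally have "?r ^ j * (\<Sum>i<m. w i ^ j * c i ^ (N - j))
        \<le> ?r ^ j * (?r * (\<Sum>i<m. w i ^ Suc j * c i ^ (N - Suc j)))"
      using predual_norm_nonneg[OF adm nsum x] by (intro mult_left_mono) auto
    then show ?case using Suc by (simp add: mult_ac)
  qed simp
  from this[of N] have "(\<Sum>i<m. c i ^ N) \<le> ?r ^ N * (\<Sum>i<m. w i ^ N)" by simp
  also have "(\<Sum>i<m. c i ^ N) = (\<Sum>k<m. cmod (x k) ^ N)"
    unfolding c_def by (rule sum.reindex_bij_betw[OF a])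
  finally show ?thesis .
qed

end

section \<open>Sums of powers as polynomials\<close>

text \<open>A crude form of Young's inequality that stands in for Hoelder's inequality in the series
  estimates.\<close>

lemma power_mult_le_add_powers:
  fixes a b :: real
  assumes "0 \<le> a" "0 \<le> b" "j \<le> N"
  shows "a ^ j * b ^ (N - j) \<le> a ^ N + b ^ N"
proof -
  have "a ^ j * b ^ (N - j) \<le> max a b ^ j * max a b ^ (N - j)"
    using assms by (intro mult_mono power_mono) auto
  also have "\<dots> = max a b ^ N" using assms(3) by (simp flip: power_add)
  also have "\<dots> \<le> a ^ N + b ^ N" using assms by (simp add: max_def)
  finally show ?thesis .
qed

lemma add_power_le:
  fixes a b :: real
  assumes "0 \<le> a" "0 \<le> b"
  shows "(a + b) ^ N \<le> 2 ^ N * (a ^ N + b ^ N)"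
proof -
  have "(a + b) ^ N \<le> (2 * max a b) ^ N" using assms by (intro power_mono) auto
  also have "\<dots> = 2 ^ N * max a b ^ N" by (simp add: power_mult_distrib)
  also have "\<dots> \<le> 2 ^ N * (a ^ N + b ^ N)" using assms by (simp add: max_def)
  finally show ?thesis .
qed

text \<open>Dividing by \<open>b\<close> brings all factors into the closed unit disc, where
  \<open>norm_prod_diff\<close> applies. With \<open>Suc m\<close> factors, \<open>m\<close> of them
  remain next to each difference.\<close>

lemma norm_prod_diff_le:
  fixes z u :: "nat \<Rightarrow> complex"
  assumes "\<And>i. i < Suc m \<Longrightarrow> cmod (z i) \<le> b" "\<And>i. i < Suc m \<Longrightarrow> cmod (u i) \<le> b"
  shows "cmod ((\<Prod>i<Suc m. z i) - (\<Prod>i<Suc m. u i)) \<le> (\<Sum>i<Suc m. cmod (z i - u i) * b ^ m)"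
proof (cases "b = 0")
  case True
  then have "z 0 = 0" "u 0 = 0" using assms[of 0] by auto
  then have "(\<Prod>i<Suc m. z i) = 0" "(\<Prod>i<Suc m. u i) = 0"
    by (auto intro!: prod_zero simp del: prod.lessThan_Suc)
  then have "cmod ((\<Prod>i<Suc m. z i) - (\<Prod>i<Suc m. u i)) = 0" by (simp only: norm_zero diff_self)
  then show ?thesis using True by (simp only:) (intro sum_nonneg; simp)
next
  case False
  then have b: "0 < b" using order_trans[OF norm_ge_zero assms(1)[of 0]] by simp
  have "cmod ((\<Prod>i<Suc m. z i / of_real b) - (\<Prod>i<Suc m. u i / of_real b))
      \<le> (\<Sum>i<Suc m. cmod (z i / of_real b - u i / of_real b))"
    using assms b by (intro norm_prod_diff) (auto simp: norm_divide)
  also have "(\<Prod>i<Suc m. z i / of_real b) - (\<Prod>i<Suc m. u i / of_real b)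
      = ((\<Prod>i<Suc m. z i) - (\<Prod>i<Suc m. u i)) / of_real b ^ Suc m"
    by (simp add: prod_dividef diff_divide_distrib del: prod.lessThan_Suc power_Suc)
  also have "(\<Sum>i<Suc m. cmod (z i / of_real b - u i / of_real b)) = (\<Sum>i<Suc m. cmod (z i - u i)) / b"
    using b by (simp add: norm_divide sum_divide_distrib del: sum.lessThan_Suc flip: diff_divide_distrib)
  finally have "cmod ((\<Prod>i<Suc m. z i) - (\<Prod>i<Suc m. u i)) / b ^ Suc m \<le> (\<Sum>i<Suc m. cmod (z i - u i)) / b"
    using b by (simp add: norm_divide norm_power del: prod.lessThan_Suc sum.lessThan_Suc power_Suc)
  then have "cmod ((\<Prod>i<Suc m. z i) - (\<Prod>i<Suc m. u i)) \<le> (\<Sum>i<Suc m. cmod (z i - u i)) / b * b ^ Suc m"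
    using b by (simp add: pos_divide_le_eq del: prod.lessThan_Suc sum.lessThan_Suc power_Suc)
  also have "\<dots> = (\<Sum>i<Suc m. cmod (z i - u i)) * b ^ m"
    using b by (simp del: sum.lessThan_Suc)
  finally show ?thesis by (simp add: sum_distrib_right del: prod.lessThan_Suc sum.lessThan_Suc)
qed

text \<open>The difference quotient estimate \<open>lemma_termdiff3\<close>, multiplied by
  \<open>h\<close>. For \<open>n \<ge> 2\<close> the right side has total degree \<open>n\<close>
  with exponent 2 on \<open>h\<close>, the shape handled by \<open>suminf_mixed_le\<close> with
  \<open>j = 2\<close>.\<close>

lemma norm_power_diff2_le:
  fixes z h :: complex
  shows "cmod ((z + h) ^ n - z ^ n - of_nat n * z ^ (n - 1) * h)
    \<le> (real n)\<^sup>2 * (cmod h ^ 2 * (cmod z + cmod h) ^ (n - 2))"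
proof (cases "h = 0")
  case False
  have "cmod (((z + h) ^ n - z ^ n) / h - of_nat n * z ^ (n - Suc 0))
      \<le> real n * real (n - Suc 0) * (cmod z + cmod h) ^ (n - 2) * cmod h"
    using False by (intro lemma_termdiff3) (auto intro: norm_triangle_ineq)
  also have "\<dots> \<le> real n * real n * (cmod z + cmod h) ^ (n - 2) * cmod h"
    by (intro mult_right_mono mult_left_mono) auto
  finally have "cmod (((z + h) ^ n - z ^ n) / h - of_nat n * z ^ (n - 1)) * cmod h
      \<le> real n * real n * (cmod z + cmod h) ^ (n - 2) * cmod h * cmod h"
    by (intro mult_right_mono) auto
  moreover have "(((z + h) ^ n - z ^ n) / h - of_nat n * z ^ (n - 1)) * h
      = (z + h) ^ n - z ^ n - of_nat n * z ^ (n - 1) * h"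
    using False by (simp only: left_diff_distrib[of _ _ h] nonzero_eq_divide_eq nonzero_divide_mult_cancel_right
        times_divide_eq_left) (simp add: diff_divide_distrib left_diff_distrib)
  ultimately have "cmod ((z + h) ^ n - z ^ n - of_nat n * z ^ (n - 1) * h)
      \<le> real n * real n * (cmod z + cmod h) ^ (n - 2) * cmod h * cmod h"
    by (metis norm_mult)
  then show ?thesis by (simp add: power2_eq_square mult_ac)
qed simp

lemma norm_scaleC_diff:
  fixes y :: "'a::complex_normed_vector"
  shows "norm (a *\<^sub>C y - b *\<^sub>C y) = cmod (a - b) * norm y"
proof -
  have "a *\<^sub>C y = (a - b) *\<^sub>C y + b *\<^sub>C y" by (simp flip: scaleC_add_left)
  then show ?thesis by (simp add: norm_scaleC)
qed

text \<open>Where the series diverges \<open>suminf\<close> is unspecified; this is harmless, as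
  only lists of \<open>N\<close> elements of the predual matter and
  \<open>summable_diagonal_form\<close> covers them.\<close>

definition diagonal_form :: "(nat \<Rightarrow> complex) list \<Rightarrow> complex"
  where "diagonal_form xs = (\<Sum>k. \<Prod>x\<leftarrow>xs. x k)"

definition power_sum :: "nat \<Rightarrow> (nat \<Rightarrow> complex) \<Rightarrow> complex"
  where "power_sum N x = (\<Sum>k. x k ^ N)"

lemma diagonal_form_replicate: "diagonal_form (replicate N x) = power_sum N x"
  by (simp add: diagonal_form_def power_sum_def prod_list_replicate)

lemma prod_list_update_apply:
  "i < length xs \<Longrightarrow>
    (\<Prod>x\<leftarrow>xs[i := u]. x k) = (u k :: complex) * (\<Prod>x\<leftarrow>take i xs @ drop (Suc i) xs. x k)"
  by (simp add: upd_conv_take_nth_drop mult_ac)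

section \<open>The embedding into l_N and estimates for the diagonal form\<close>

context
  fixes w :: "nat \<Rightarrow> real" and N :: nat
  assumes adm: "admissible w" and nsum: "\<not> summable w"
    and wN: "summable (\<lambda>n. w n ^ N)" and N: "N \<ge> 2"
begin

lemma suminf_weight_nonneg: "0 \<le> (\<Sum>n. w n ^ N)"
  using w_nonneg[OF adm nsum] by (intro suminf_nonneg[OF wN]) auto

text \<open>Summability of \<open>w n ^ N\<close> makes the bound of \<open>sum_power_le\<close>
  uniform in \<open>m\<close>; this is the embedding into l_N.\<close>

lemma
  assumes x: "x \<in> predual_space w"
  shows summable_powers: "summable (\<lambda>k. cmod (x k) ^ N)"
    and suminf_powers_le: "(\<Sum>k. cmod (x k) ^ N) \<le> predual_norm w x ^ N * (\<Sum>n. w n ^ N)"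
proof -
  have le: "(\<Sum>k<m. cmod (x k) ^ N) \<le> predual_norm w x ^ N * (\<Sum>n. w n ^ N)" for m
  proof -
    have "(\<Sum>k<m. w k ^ N) \<le> (\<Sum>n. w n ^ N)"
      using w_nonneg[OF adm nsum] by (intro sum_le_suminf[OF wN]) auto
    then have "predual_norm w x ^ N * (\<Sum>k<m. w k ^ N) \<le> predual_norm w x ^ N * (\<Sum>n. w n ^ N)"
      using predual_norm_nonneg[OF adm nsum x] by (intro mult_left_mono) auto
    then show ?thesis using sum_power_le[OF adm nsum x, where m = m and N = N] by simp
  qed
  show s: "summable (\<lambda>k. cmod (x k) ^ N)"
    using le by (intro summableI_nonneg_bounded) auto
  show "(\<Sum>k. cmod (x k) ^ N) \<le> predual_norm w x ^ N * (\<Sum>n. w n ^ N)"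
    using s le by (rule suminf_le_const)
qed

text \<open>Dividing \<open>x\<close> by \<open>s\<close> before applying
  \<open>power_mult_le_add_powers\<close> makes the bound proportional to \<open>s ^ j\<close>. The
  case \<open>j = 1\<close> yields Lipschitz estimates and the bounded derivative,
  \<open>j = 2\<close> the quadratic remainder. As \<open>s\<close> must be positive, the zero
  vector is treated separately where \<open>s\<close> is a norm.\<close>

lemma
  assumes x: "x \<in> predual_space w" "predual_norm w x \<le> s" "0 < s"
    and b: "\<And>k. 0 \<le> b k" "summable (\<lambda>k. b k ^ N)" and j: "j \<le> N"
  shows summable_mixed: "summable (\<lambda>k. cmod (x k) ^ j * b k ^ (N - j))"
    and suminf_mixed_le: "(\<Sum>k. cmod (x k) ^ j * b k ^ (N - j))
      \<le> s ^ j * ((\<Sum>n. w n ^ N) + (\<Sum>k. b k ^ N))"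
proof -
  let ?f = "\<lambda>k. cmod (x k) ^ j * b k ^ (N - j)"
  let ?g = "\<lambda>k. s ^ j * (cmod (x k) ^ N / s ^ N + b k ^ N)"
  have fg: "?f k \<le> ?g k" for k
  proof -
    have "(cmod (x k) / s) ^ j * b k ^ (N - j) \<le> (cmod (x k) / s) ^ N + b k ^ N"
      using x(3) b(1) j by (intro power_mult_le_add_powers) auto
    then have "s ^ j * ((cmod (x k) / s) ^ j * b k ^ (N - j)) \<le> s ^ j * ((cmod (x k) / s) ^ N + b k ^ N)"
      using x(3) by (intro mult_left_mono) auto
    then show ?thesis using x(3) by (simp add: power_divide)
  qed
  have g: "?g sums (s ^ j * ((\<Sum>k. cmod (x k) ^ N) / s ^ N + (\<Sum>k. b k ^ N)))"
    by (intro sums_mult sums_add sums_divide summable_sums summable_powers x(1) b(2))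
  show f: "summable ?f"
    using fg b(1) by (intro summable_comparison_test'[OF sums_summable[OF g], of 0]) auto
  have "(\<Sum>k. cmod (x k) ^ N) \<le> s ^ N * (\<Sum>n. w n ^ N)"
    using power_mono[OF x(2) predual_norm_nonneg[OF adm nsum x(1)], of N] suminf_weight_nonneg
    by (intro order_trans[OF suminf_powers_le[OF x(1)] mult_right_mono])
  then have "(\<Sum>k. cmod (x k) ^ N) / s ^ N \<le> (\<Sum>n. w n ^ N)"
    using x(3) by (simp add: pos_divide_le_eq mult.commute)
  then have "s ^ j * ((\<Sum>k. cmod (x k) ^ N) / s ^ N + (\<Sum>k. b k ^ N))
      \<le> s ^ j * ((\<Sum>n. w n ^ N) + (\<Sum>k. b k ^ N))"
    using x(3) by (intro mult_left_mono) auto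
  with sums_le[OF fg summable_sums[OF f] g]
  show "suminf ?f \<le> s ^ j * ((\<Sum>n. w n ^ N) + (\<Sum>k. b k ^ N))" by simp
qed

text \<open>The pointwise maximum works because its \<open>N\<close>-th power is at most the sum of
  the \<open>N\<close>-th powers. It lets a single sequence in l_N dominate every factor of a
  diagonal product.\<close>

lemma common_majorant:
  assumes F: "finite F" "F \<noteq> {}" "F \<subseteq> predual_space w" "\<And>x. x \<in> F \<Longrightarrow> predual_norm w x \<le> \<rho>"
  shows "\<exists>b. (\<forall>x\<in>F. \<forall>k. cmod (x k) \<le> b k) \<and> summable (\<lambda>k. b k ^ N) \<and>
    (\<Sum>k. b k ^ N) \<le> real (card F) * (\<rho> ^ N * (\<Sum>n. w n ^ N))"
proof -
  define b where "b k = Max ((\<lambda>x. cmod (x k)) ` F)" for k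
  have le: "cmod (x k) \<le> b k" if "x \<in> F" for x k
    unfolding b_def using F(1) that by (intro Max_ge) auto
  have bN: "b k ^ N \<le> (\<Sum>x\<in>F. cmod (x k) ^ N)" "0 \<le> b k" for k
  proof -
    have "b k \<in> (\<lambda>x. cmod (x k)) ` F"
      unfolding b_def using F(1,2) by (intro Max_in) auto
    then obtain x where x: "x \<in> F" "b k = cmod (x k)" by blast
    show "b k ^ N \<le> (\<Sum>x\<in>F. cmod (x k) ^ N)"
      unfolding x(2) using F(1) x(1) member_le_sum[of x F "\<lambda>x. cmod (x k) ^ N"] by simp
    show "0 \<le> b k" by (simp add: x(2))
  qed
  have g: "(\<lambda>k. \<Sum>x\<in>F. cmod (x k) ^ N) sums (\<Sum>x\<in>F. \<Sum>k. cmod (x k) ^ N)"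
    using F(3) by (intro sums_sum summable_sums summable_powers) auto
  have s: "summable (\<lambda>k. b k ^ N)"
    using bN by (intro summable_comparison_test'[OF sums_summable[OF g], of 0]) auto
  have "(\<Sum>k. b k ^ N) \<le> (\<Sum>x\<in>F. \<Sum>k. cmod (x k) ^ N)"
    by (rule sums_le[OF bN(1) summable_sums[OF s] g])
  also have "\<dots> \<le> (\<Sum>x\<in>F. \<rho> ^ N * (\<Sum>n. w n ^ N))"
  proof (rule sum_mono)
    fix x assume x: "x \<in> F"
    then have "predual_norm w x ^ N \<le> \<rho> ^ N"
      using F(3,4) predual_norm_nonneg[OF adm nsum] by (intro power_mono) auto
    then show "(\<Sum>k. cmod (x k) ^ N) \<le> \<rho> ^ N * (\<Sum>n. w n ^ N)"
      using F(3) x suminf_weight_nonneg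
      by (intro order_trans[OF suminf_powers_le mult_right_mono]) auto
  qed
  finally show ?thesis using le s by (intro exI[of _ b]) simp
qed

lemma prod_list_apply:
  "length xs = N \<Longrightarrow> (\<Prod>x\<leftarrow>xs. x k) = (\<Prod>i<N. (xs ! i) k :: complex)"
  by (simp add: prod.list_conv_set_nth atLeast0LessThan)

lemma summable_diagonal_form:
  assumes "length xs = N" "set xs \<subseteq> predual_space w"
  shows "summable (\<lambda>k. \<Prod>x\<leftarrow>xs. x k)"
proof -
  have ne: "set xs \<noteq> {}" using assms(1) N by auto
  obtain b where b: "\<And>x k. x \<in> set xs \<Longrightarrow> cmod (x k) \<le> b k" "summable (\<lambda>k. b k ^ N)"
    using common_majorant[of "set xs" "Max (predual_norm w ` set xs)"] assms(2) ne by auto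
  have "cmod (\<Prod>x\<leftarrow>xs. x k) \<le> b k ^ N" for k
  proof -
    have "cmod (\<Prod>x\<leftarrow>xs. x k) = (\<Prod>i<N. cmod ((xs ! i) k))"
      by (simp add: prod_list_apply[OF assms(1)] prod_norm)
    also have "\<dots> \<le> (\<Prod>i<N. b k)"
      using b(1) assms(1) by (intro prod_mono) auto
    finally show ?thesis by simp
  qed
  then show ?thesis by (intro summable_comparison_test'[OF b(2), of 0])
qed

text \<open>In each telescoped product one factor is a difference of entries and the other
  \<open>N - 1\<close> lie below a common majorant of both lists, so \<open>suminf_mixed_le\<close>
  with \<open>j = 1\<close> gives a bound linear in \<open>s\<close>. The factor
  \<open>2 * real N\<close> counts the entries of the two lists.\<close>

lemma diagonal_form_diff_le:
  assumes xs: "length xs = N" "set xs \<subseteq> predual_space w" "\<And>x. x \<in> set xs \<Longrightarrow> predual_norm w x \<le> \<rho>"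
    and ys: "length ys = N" "set ys \<subseteq> predual_space w" "\<And>x. x \<in> set ys \<Longrightarrow> predual_norm w x \<le> \<rho>"
    and s: "0 < s" "\<And>i. i < N \<Longrightarrow> predual_norm w (ys ! i - xs ! i) \<le> s"
  shows "cmod (diagonal_form ys - diagonal_form xs)
    \<le> s * (real N * ((\<Sum>n. w n ^ N) + 2 * real N * (\<rho> ^ N * (\<Sum>n. w n ^ N))))"
proof -
  let ?F = "set ys \<union> set xs" and ?C = "\<Sum>n. w n ^ N"
  have ne: "?F \<noteq> {}" using xs(1) N by auto
  obtain b where b: "\<And>x k. x \<in> ?F \<Longrightarrow> cmod (x k) \<le> b k" "summable (\<lambda>k. b k ^ N)"
      "(\<Sum>k. b k ^ N) \<le> real (card ?F) * (\<rho> ^ N * ?C)"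
  proof -
    have "finite ?F" "?F \<subseteq> predual_space w" "\<And>x. x \<in> ?F \<Longrightarrow> predual_norm w x \<le> \<rho>"
      using xs(2,3) ys(2,3) by auto
    from common_majorant[OF this(1) ne this(2,3)] show ?thesis using that by blast
  qed
  have "xs ! 0 \<in> set xs" using xs(1) N by simp
  then have b0: "0 \<le> b k" for k using order_trans[OF norm_ge_zero b(1)] by blast
  have "0 \<le> \<rho>"
    using \<open>xs ! 0 \<in> set xs\<close> xs(2) xs(3)[of "xs ! 0"] predual_norm_nonneg[OF adm nsum, of "xs ! 0"] by auto
  have "real (card ?F) \<le> 2 * real N"
    using card_Un_le[of "set ys" "set xs"] card_length[of xs] card_length[of ys] xs(1) ys(1) by linarith
  then have B: "(\<Sum>k. b k ^ N) \<le> 2 * real N * (\<rho> ^ N * ?C)"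
    using \<open>0 \<le> \<rho>\<close> suminf_weight_nonneg by (intro order_trans[OF b(3)] mult_right_mono) auto
  define d where "d i = ys ! i - xs ! i" for i
  have dX: "d i \<in> predual_space w" "predual_norm w (d i) \<le> s" if "i < N" for i
    unfolding d_def using xs(1,2) ys(1,2) s(2) that
    by (auto intro!: predual_space_diff[OF adm nsum])
  have sm: "summable (\<lambda>k. cmod (d i k) ^ 1 * b k ^ (N - 1))"
      "(\<Sum>k. cmod (d i k) ^ 1 * b k ^ (N - 1)) \<le> s ^ 1 * (?C + (\<Sum>k. b k ^ N))" if "i < N" for i
    using summable_mixed[OF dX[OF that] s(1) b0 b(2), of 1]
      suminf_mixed_le[OF dX[OF that] s(1) b0 b(2), of 1] N by simp_all
  have sN: "Suc (N - 1) = N" using N by simp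
  have pt: "cmod ((\<Prod>x\<leftarrow>ys. x k) - (\<Prod>x\<leftarrow>xs. x k)) \<le> (\<Sum>i<N. cmod (d i k) ^ 1 * b k ^ (N - 1))" for k
    using norm_prod_diff_le[of "N - 1" "\<lambda>i. (ys ! i) k" "b k" "\<lambda>i. (xs ! i) k", unfolded sN]
      b(1) xs(1) ys(1)
    by (simp add: prod_list_apply d_def)
  have sums: "(\<lambda>k. \<Sum>i<N. cmod (d i k) ^ 1 * b k ^ (N - 1)) sums
      (\<Sum>i<N. \<Sum>k. cmod (d i k) ^ 1 * b k ^ (N - 1))"
    using sm(1) by (intro sums_sum summable_sums) auto
  have "diagonal_form ys - diagonal_form xs = (\<Sum>k. (\<Prod>x\<leftarrow>ys. x k) - (\<Prod>x\<leftarrow>xs. x k))"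
    unfolding diagonal_form_def
    using suminf_diff[OF summable_diagonal_form[OF ys(1,2)] summable_diagonal_form[OF xs(1,2)]] by simp
  also have "cmod \<dots> \<le> (\<Sum>k. \<Sum>i<N. cmod (d i k) ^ 1 * b k ^ (N - 1))"
    by (rule norm_suminf_le[OF pt sums_summable[OF sums]])
  also have "\<dots> = (\<Sum>i<N. \<Sum>k. cmod (d i k) ^ 1 * b k ^ (N - 1))"
    using sums_unique[OF sums] by simp
  also have "\<dots> \<le> (\<Sum>i<N. s * (?C + 2 * real N * (\<rho> ^ N * ?C)))"
  proof (rule sum_mono)
    fix i assume "i \<in> {..<N}"
    then have "(\<Sum>k. cmod (d i k) ^ 1 * b k ^ (N - 1)) \<le> s * (?C + (\<Sum>k. b k ^ N))"
      using sm(2) by simp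
    also have "\<dots> \<le> s * (?C + 2 * real N * (\<rho> ^ N * ?C))"
      using s(1) B by (intro mult_left_mono) auto
    finally show "(\<Sum>k. cmod (d i k) ^ 1 * b k ^ (N - 1)) \<le> s * (?C + 2 * real N * (\<rho> ^ N * ?C))" .
  qed
  finally show ?thesis by (simp add: mult_ac)
qed

lemma diagonal_form_multilinear:
  fixes y0 :: "'y::complex_normed_vector"
  shows "continuous_symmetric_multilinear (predual_space w) (predual_norm w) N
    (\<lambda>xs. diagonal_form xs *\<^sub>C y0)"
  unfolding continuous_symmetric_multilinear_def
proof (intro allI impI conjI ballI)
  fix xs :: "(nat \<Rightarrow> complex) list"
  assume xs: "length xs = N \<and> set xs \<subseteq> predual_space w"
  {
    fix i u v c assume i: "i < N" and u: "u \<in> predual_space w" and v: "v \<in> predual_space w"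
    have sm: "summable (\<lambda>k. u k * (\<Prod>x\<leftarrow>take i xs @ drop (Suc i) xs. x k))"
      if "u \<in> predual_space w" for u
      using summable_diagonal_form[of "xs[i := u]"] xs i that set_update_subset_insert[of xs i u]
      by (auto simp: prod_list_update_apply)
    have "diagonal_form (xs[i := u + v]) = diagonal_form (xs[i := u]) + diagonal_form (xs[i := v])"
      using suminf_add[OF sm[OF u] sm[OF v]] xs i
      by (simp add: diagonal_form_def prod_list_update_apply distrib_right)
    then show "diagonal_form (xs[i := u + v]) *\<^sub>C y0
        = diagonal_form (xs[i := u]) *\<^sub>C y0 + diagonal_form (xs[i := v]) *\<^sub>C y0"
      by (simp add: scaleC_add_left)
    have "diagonal_form (xs[i := c *\<^sub>C u]) = c * diagonal_form (xs[i := u])"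
      using suminf_mult[OF sm[OF u], of c] xs i
      by (simp add: diagonal_form_def prod_list_update_apply scaleC_fun_def scaleC_complex_def mult_ac)
    then show "diagonal_form (xs[i := c *\<^sub>C u]) *\<^sub>C y0 = c *\<^sub>C diagonal_form (xs[i := u]) *\<^sub>C y0"
      by (simp add: scaleC_scaleC)
  }
  show "diagonal_form ys *\<^sub>C y0 = diagonal_form xs *\<^sub>C y0" if "mset ys = mset xs" for ys
  proof -
    have "(\<Prod>x\<leftarrow>ys. x k) = (\<Prod>x\<leftarrow>xs. x k)" for k
      using that by (metis mset_map prod_mset_prod_list)
    then show ?thesis by (simp add: diagonal_form_def)
  qed
  fix \<epsilon> :: real assume \<epsilon>: "0 < \<epsilon>"
  \<comment> \<open>The extra 1 keeps the entries of every \<open>ys\<close> with distance below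
    \<open>\<delta> \<le> 1\<close> within norm \<rho> as well.\<close>
  define \<rho> where "\<rho> = Max (predual_norm w ` set xs) + 1"
  have \<rho>: "predual_norm w x + 1 \<le> \<rho>" if "x \<in> set xs" for x
    using that by (simp add: \<rho>_def)
  have "hd xs \<in> set xs" using xs N by (intro hd_in_set) auto
  then have "0 \<le> \<rho>"
    using \<rho>[of "hd xs"] predual_norm_nonneg[OF adm nsum, of "hd xs"] xs by auto
  define K where "K = real N * ((\<Sum>n. w n ^ N) + 2 * real N * (\<rho> ^ N * (\<Sum>n. w n ^ N)))"
  have K: "0 \<le> K" unfolding K_def using \<open>0 \<le> \<rho>\<close> suminf_weight_nonneg by auto
  \<comment> \<open>The summand 1 in the denominator covers \<open>K * norm y0 = 0\<close> and makes
    the final inequality strict.\<close>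
  define \<delta> where "\<delta> = min 1 (\<epsilon> / (K * norm y0 + 1))"
  have K1: "0 < K * norm y0 + 1" using K by (simp add: add_nonneg_pos)
  then have \<delta>: "0 < \<delta>" "\<delta> \<le> 1" "\<delta> \<le> \<epsilon> / (K * norm y0 + 1)" using \<epsilon> by (auto simp: \<delta>_def)
  show "\<exists>\<delta>>0. \<forall>ys. length ys = N \<and> set ys \<subseteq> predual_space w \<and>
      (\<forall>i<N. predual_norm w (ys ! i - xs ! i) < \<delta>) \<longrightarrow>
      norm (diagonal_form ys *\<^sub>C y0 - diagonal_form xs *\<^sub>C y0) < \<epsilon>"
  proof (intro exI[of _ \<delta>] conjI allI impI \<delta>(1), elim conjE)
    fix ys assume ys: "length ys = N" "set ys \<subseteq> predual_space w"
      and near: "\<forall>i<N. predual_norm w (ys ! i - xs ! i) < \<delta>"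
    have "predual_norm w y \<le> \<rho>" if "y \<in> set ys" for y
    proof -
      obtain i where i: "i < N" "y = ys ! i" using \<open>y \<in> set ys\<close> ys(1) by (auto simp: in_set_conv_nth)
      have xi: "xs ! i \<in> set xs" using i xs by auto
      have "predual_norm w (xs ! i + (y - xs ! i)) \<le> predual_norm w (xs ! i) + predual_norm w (y - xs ! i)"
        using xs xi ys(2) that
        by (intro predual_space_add(2)[OF adm nsum] predual_space_diff[OF adm nsum]) auto
      then show ?thesis using \<rho>[OF xi] near i \<delta>(2) by force
    qed
    then have "cmod (diagonal_form ys - diagonal_form xs) \<le> \<delta> * K"
      unfolding K_def using xs ys near \<delta>(1) \<rho>
      by (intro diagonal_form_diff_le) (auto intro: less_imp_le dest: \<rho>)
    then have "norm (diagonal_form ys *\<^sub>C y0 - diagonal_form xs *\<^sub>C y0) \<le> \<delta> * K * norm y0"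
      unfolding norm_scaleC_diff by (rule mult_right_mono) simp
    also have "\<dots> = \<delta> * (K * norm y0)" by simp
    also have "\<dots> < \<delta> * (K * norm y0 + 1)" using \<delta>(1) by simp
    also have "\<dots> \<le> \<epsilon>" using \<delta>(3) K1 by (simp add: pos_le_divide_eq)
    finally show "norm (diagonal_form ys *\<^sub>C y0 - diagonal_form xs *\<^sub>C y0) < \<epsilon>" .
  qed
qed

section \<open>The power sum as a polynomial that is uniformly continuous and holomorphic on the
  ball\<close>

lemma power_sum_hom_polynomial:
  fixes y0 :: "'y::complex_normed_vector"
  shows "(\<lambda>x. power_sum N x *\<^sub>C y0) \<in> hom_polynomials (predual_space w) (predual_norm w) N"
  unfolding hom_polynomials_def mem_Collect_eq
  by (rule exI, rule conjI[OF diagonal_form_multilinear[of y0]]) (simp add: diagonal_form_replicate)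

lemma power_sum_summable:
  assumes "x \<in> predual_space w"
  shows "summable (\<lambda>k. x k ^ N)"
  by (rule summable_norm_cancel) (simp add: norm_power summable_powers[OF assms])

lemma power_sum_le:
  assumes "x \<in> predual_space w"
  shows "cmod (power_sum N x) \<le> predual_norm w x ^ N * (\<Sum>n. w n ^ N)"
  unfolding power_sum_def
  by (rule order_trans[OF norm_suminf_le[OF _ summable_powers[OF assms]] suminf_powers_le[OF assms]])
     (simp add: norm_power)

lemma power_sum_unif_cont:
  fixes y0 :: "'y::complex_normed_vector"
  shows "unif_cont_on_ball (predual_space w) (predual_norm w) (\<lambda>x. power_sum N x *\<^sub>C y0)"
  unfolding unif_cont_on_ball_def
proof (intro allI impI)
  fix \<epsilon> :: real assume \<epsilon>: "0 < \<epsilon>"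
  \<comment> \<open>The constant of \<open>diagonal_form_diff_le\<close> for
    \<open>\<rho> = 1\<close>, with \<open>1 ^ N\<close> left in place to match its form.\<close>
  define K where "K = real N * ((\<Sum>n. w n ^ N) + 2 * real N * (1 ^ N * (\<Sum>n. w n ^ N)))"
  have K: "0 \<le> K" unfolding K_def using suminf_weight_nonneg by auto
  define \<delta> where "\<delta> = \<epsilon> / (K * norm y0 + 1)"
  have K1: "0 < K * norm y0 + 1" using K by (simp add: add_nonneg_pos)
  then have \<delta>: "0 < \<delta>" using \<epsilon> by (auto simp: \<delta>_def)
  show "\<exists>\<delta>>0. \<forall>x\<in>open_unit_ball (predual_space w) (predual_norm w).
      \<forall>y\<in>open_unit_ball (predual_space w) (predual_norm w).
      predual_norm w (x - y) < \<delta> \<longrightarrow> norm (power_sum N x *\<^sub>C y0 - power_sum N y *\<^sub>C y0) < \<epsilon>"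
  proof (intro exI[of _ \<delta>] conjI ballI impI \<delta>)
    fix x y assume "x \<in> open_unit_ball (predual_space w) (predual_norm w)"
      "y \<in> open_unit_ball (predual_space w) (predual_norm w)" "predual_norm w (x - y) < \<delta>"
    then have "cmod (power_sum N x - power_sum N y) \<le> \<delta> * K"
      unfolding K_def diagonal_form_replicate[symmetric] using \<delta>
      by (intro diagonal_form_diff_le) (auto simp: open_unit_ball_def)
    then have "norm (power_sum N x *\<^sub>C y0 - power_sum N y *\<^sub>C y0) \<le> \<delta> * K * norm y0"
      unfolding norm_scaleC_diff by (rule mult_right_mono) simp
    also have "\<dots> = \<delta> * (K * norm y0)" by simp
    also have "\<dots> < \<delta> * (K * norm y0 + 1)" using \<delta> by simp
    also have "\<dots> = \<epsilon>" using K1 by (simp add: \<delta>_def)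
    finally show "norm (power_sum N x *\<^sub>C y0 - power_sum N y *\<^sub>C y0) < \<epsilon>" .
  qed
qed

definition power_sum_deriv :: "(nat \<Rightarrow> complex) \<Rightarrow> (nat \<Rightarrow> complex) \<Rightarrow> complex"
  where "power_sum_deriv x h = (\<Sum>k. of_nat N * x k ^ (N - 1) * h k)"

lemma
  assumes x: "x \<in> predual_space w" and h: "h \<in> predual_space w"
  shows power_sum_deriv_summable: "summable (\<lambda>k. of_nat N * x k ^ (N - 1) * h k)"
    and power_sum_deriv_le: "cmod (power_sum_deriv x h)
      \<le> real N * ((\<Sum>n. w n ^ N) + (\<Sum>k. cmod (x k) ^ N)) * predual_norm w h"
proof -
  let ?f = "\<lambda>k. of_nat N * x k ^ (N - 1) * h k"
  let ?g = "\<lambda>k. cmod (h k) ^ 1 * cmod (x k) ^ (N - 1)"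
  have fg: "cmod (?f k) \<le> real N * ?g k" for k
    by (simp add: norm_mult norm_power mult_ac)
  have "summable ?f \<and> cmod (suminf ?f)
      \<le> real N * ((\<Sum>n. w n ^ N) + (\<Sum>k. cmod (x k) ^ N)) * predual_norm w h"
  \<comment> \<open>The mixed estimates are used with \<open>h\<close> as the vector, the moduli of
    \<open>x\<close> as majorant and the norm of \<open>h\<close> as scale, which must be
    positive.\<close>
  proof (cases "h = 0")
    case False
    note s = predual_norm_pos[OF adm nsum h False]
    have g: "summable ?g"
      using N by (intro summable_mixed[OF h order_refl s _ summable_powers[OF x]]) auto
    have "suminf ?g \<le> predual_norm w h ^ 1 * ((\<Sum>n. w n ^ N) + (\<Sum>k. cmod (x k) ^ N))"
      using N by (intro suminf_mixed_le[OF h order_refl s _ summable_powers[OF x]]) auto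
    then have "real N * suminf ?g
        \<le> real N * (predual_norm w h ^ 1 * ((\<Sum>n. w n ^ N) + (\<Sum>k. cmod (x k) ^ N)))"
      by (intro mult_left_mono) auto
    moreover have "cmod (suminf ?f) \<le> (\<Sum>k. real N * ?g k)"
      by (rule norm_suminf_le[OF fg summable_mult[OF g]])
    moreover have "summable ?f"
      using fg by (intro summable_comparison_test'[OF summable_mult[OF g, of "real N"], of 0]) auto
    ultimately show ?thesis using suminf_mult[OF g, of "real N"] by (simp add: mult_ac)
  qed (simp add: zero_predual(2)[OF adm nsum])
  then show "summable ?f" "cmod (power_sum_deriv x h)
      \<le> real N * ((\<Sum>n. w n ^ N) + (\<Sum>k. cmod (x k) ^ N)) * predual_norm w h"
    by (simp_all add: power_sum_deriv_def)
qed

text \<open>Termwise Taylor remainders are summed by \<open>suminf_mixed_le\<close> with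
  \<open>j = 2\<close> and majorant \<open>cmod (x k) + cmod (h k)\<close>. Restricting to norm at
  most 1 makes the constant independent of \<open>h\<close>; its factor \<open>2 ^ N\<close> comes
  from \<open>add_power_le\<close>.\<close>

lemma power_sum_remainder_le:
  assumes x: "x \<in> predual_space w" and h: "h \<in> predual_space w" and "predual_norm w h \<le> 1"
  shows "cmod (power_sum N (x + h) - power_sum N x - power_sum_deriv x h)
    \<le> (real N)\<^sup>2 * ((\<Sum>n. w n ^ N) + 2 ^ N * ((\<Sum>k. cmod (x k) ^ N) + (\<Sum>n. w n ^ N))) * (predual_norm w h)\<^sup>2"
    (is "_ \<le> (real N)\<^sup>2 * ?M * _")
proof (cases "h = 0")
  case True
  then have "power_sum_deriv x h = 0" by (simp add: power_sum_deriv_def)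
  then show ?thesis using True by (simp add: zero_predual(2)[OF adm nsum])
next
  case False
  note s = predual_norm_pos[OF adm nsum h False]
  let ?b = "\<lambda>k. cmod (x k) + cmod (h k)"
  let ?g = "\<lambda>k. cmod (h k) ^ 2 * ?b k ^ (N - 2)"
  let ?t = "\<lambda>k. 2 ^ N * (cmod (x k) ^ N + cmod (h k) ^ N)"
  have t: "?t sums (2 ^ N * ((\<Sum>k. cmod (x k) ^ N) + (\<Sum>k. cmod (h k) ^ N)))"
    by (intro sums_mult sums_add summable_sums summable_powers x h)
  have bt: "?b k ^ N \<le> ?t k" for k by (intro add_power_le) auto
  have b: "summable (\<lambda>k. ?b k ^ N)"
    using bt by (intro summable_comparison_test'[OF sums_summable[OF t], of 0]) auto
  have "(\<Sum>k. cmod (h k) ^ N) \<le> predual_norm w h ^ N * (\<Sum>n. w n ^ N)"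
    by (rule suminf_powers_le[OF h])
  also have "\<dots> \<le> 1 * (\<Sum>n. w n ^ N)"
    using assms(3) s by (intro mult_right_mono suminf_weight_nonneg power_le_one) auto
  finally have "(\<Sum>k. cmod (h k) ^ N) \<le> (\<Sum>n. w n ^ N)" by simp
  then have "2 ^ N * ((\<Sum>k. cmod (x k) ^ N) + (\<Sum>k. cmod (h k) ^ N))
      \<le> 2 ^ N * ((\<Sum>k. cmod (x k) ^ N) + (\<Sum>n. w n ^ N))" by simp
  with sums_le[OF bt summable_sums[OF b] t]
  have B: "(\<Sum>k. ?b k ^ N) \<le> 2 ^ N * ((\<Sum>k. cmod (x k) ^ N) + (\<Sum>n. w n ^ N))" by linarith
  have g: "summable ?g"
    using N by (intro summable_mixed[OF h order_refl s _ b]) auto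
  have "suminf ?g \<le> (predual_norm w h)\<^sup>2 * ((\<Sum>n. w n ^ N) + (\<Sum>k. ?b k ^ N))"
    using N by (intro suminf_mixed_le[OF h order_refl s _ b]) auto
  also have "\<dots> \<le> (predual_norm w h)\<^sup>2 * ?M"
    using B by (intro mult_left_mono add_mono) auto
  finally have G: "suminf ?g \<le> (predual_norm w h)\<^sup>2 * ?M" .
  have "power_sum N (x + h) - power_sum N x - power_sum_deriv x h
      = (\<Sum>k. (x k + h k) ^ N - x k ^ N - of_nat N * x k ^ (N - 1) * h k)"
    using power_sum_summable[OF predual_space_add(1)[OF adm nsum x h]] power_sum_summable[OF x]
      power_sum_deriv_summable[OF x h]
    by (simp add: power_sum_def power_sum_deriv_def suminf_diff[symmetric] summable_diff)
  also have "cmod \<dots> \<le> (\<Sum>k. (real N)\<^sup>2 * ?g k)"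
    by (rule norm_suminf_le[OF norm_power_diff2_le summable_mult[OF g]])
  also have "\<dots> = (real N)\<^sup>2 * suminf ?g" by (rule suminf_mult[OF g])
  also have "\<dots> \<le> (real N)\<^sup>2 * ((predual_norm w h)\<^sup>2 * ?M)"
    using G by (intro mult_left_mono) auto
  finally show ?thesis by (simp add: mult_ac)
qed

lemma power_sum_holomorphic:
  fixes y0 :: "'y::complex_normed_vector"
  shows "holomorphic_on_ball (predual_space w) (predual_norm w) (\<lambda>x. power_sum N x *\<^sub>C y0)"
  unfolding holomorphic_on_ball_def
proof
  fix x assume "x \<in> open_unit_ball (predual_space w) (predual_norm w)"
  then have x: "x \<in> predual_space w" by (simp add: open_unit_ball_def)
  let ?L = "\<lambda>h. power_sum_deriv x h *\<^sub>C y0"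
  have "bounded_clinear_on (predual_space w) (predual_norm w) ?L"
    unfolding bounded_clinear_on_def
  proof (intro conjI ballI allI)
    fix u v assume uv: "u \<in> predual_space w" "v \<in> predual_space w"
    have "power_sum_deriv x (u + v) = power_sum_deriv x u + power_sum_deriv x v"
      using suminf_add[OF power_sum_deriv_summable[OF x uv(1)] power_sum_deriv_summable[OF x uv(2)]]
      by (simp add: power_sum_deriv_def distrib_left)
    then show "?L (u + v) = ?L u + ?L v" by (simp add: scaleC_add_left)
  next
    fix c u assume u: "u \<in> predual_space w"
    have "power_sum_deriv x (c *\<^sub>C u) = c * power_sum_deriv x u"
      using suminf_mult[OF power_sum_deriv_summable[OF x u], of c]
      by (simp add: power_sum_deriv_def scaleC_fun_def scaleC_complex_def mult_ac)
    then show "?L (c *\<^sub>C u) = c *\<^sub>C ?L u" by (simp add: scaleC_scaleC)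
  next
    show "\<exists>K. \<forall>u\<in>predual_space w. norm (?L u) \<le> K * predual_norm w u"
    proof (intro exI ballI)
      fix u assume u: "u \<in> predual_space w"
      show "norm (?L u)
          \<le> (real N * ((\<Sum>n. w n ^ N) + (\<Sum>k. cmod (x k) ^ N)) * norm y0) * predual_norm w u"
        using mult_right_mono[OF power_sum_deriv_le[OF x u], of "norm y0"]
        by (simp add: norm_scaleC mult_ac)
    qed
  qed
  moreover have "\<exists>\<delta>>0. \<forall>h\<in>predual_space w. predual_norm w h < \<delta> \<longrightarrow>
      norm (power_sum N (x + h) *\<^sub>C y0 - power_sum N x *\<^sub>C y0 - ?L h) \<le> \<epsilon> * predual_norm w h"
    if \<epsilon>: "0 < \<epsilon>" for \<epsilon>
  proof -
    define M where "M = (real N)\<^sup>2 * ((\<Sum>n. w n ^ N) + 2 ^ N * ((\<Sum>k. cmod (x k) ^ N) + (\<Sum>n. w n ^ N)))"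
    have "0 \<le> (\<Sum>k. cmod (x k) ^ N)" by (rule suminf_nonneg[OF summable_powers[OF x]]) simp
    then have M: "0 \<le> M" unfolding M_def using suminf_weight_nonneg by auto
    \<comment> \<open>The bound 1 serves \<open>power_sum_remainder_le\<close>; the other one turns
      one of the two factors \<open>predual_norm w h\<close>, together with the constant, into
      \<epsilon>.\<close>
    define \<delta> where "\<delta> = min 1 (\<epsilon> / (M * norm y0 + 1))"
    have M1: "0 < M * norm y0 + 1" using M by (simp add: add_nonneg_pos)
    have \<delta>: "0 < \<delta>" "\<delta> \<le> 1" "\<delta> \<le> \<epsilon> / (M * norm y0 + 1)" using \<epsilon> M1 by (auto simp: \<delta>_def)
    have "norm (power_sum N (x + h) *\<^sub>C y0 - power_sum N x *\<^sub>C y0 - ?L h) \<le> \<epsilon> * predual_norm w h"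
      if h: "h \<in> predual_space w" "predual_norm w h < \<delta>" for h
    proof -
      let ?s = "predual_norm w h"
      have s: "0 \<le> ?s" by (rule predual_norm_nonneg[OF adm nsum h(1)])
      let ?a = "power_sum N (x + h) - power_sum N x"
      have "power_sum N (x + h) *\<^sub>C y0 = ?a *\<^sub>C y0 + power_sum N x *\<^sub>C y0"
        by (simp flip: scaleC_add_left)
      then have "norm (power_sum N (x + h) *\<^sub>C y0 - power_sum N x *\<^sub>C y0 - ?L h)
          = cmod (?a - power_sum_deriv x h) * norm y0"
        by (simp add: norm_scaleC_diff)
      also have "\<dots> \<le> M * ?s\<^sup>2 * norm y0"
        unfolding M_def using h \<delta>(2)
        by (intro mult_right_mono power_sum_remainder_le x) auto
      also have "\<dots> = (M * norm y0) * ?s * ?s" by (simp add: power2_eq_square mult_ac)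
      also have "\<dots> \<le> (M * norm y0 + 1) * (\<epsilon> / (M * norm y0 + 1)) * ?s"
        using h(2) \<delta>(3) s M1 M by (intro mult_right_mono mult_mono) auto
      also have "\<dots> = \<epsilon> * ?s" using M1 by simp
      finally show ?thesis .
    qed
    with \<delta>(1) show ?thesis by blast
  qed
  ultimately show "\<exists>L. bounded_clinear_on (predual_space w) (predual_norm w) L \<and>
      (\<forall>\<epsilon>>0. \<exists>\<delta>>0. \<forall>h\<in>predual_space w. predual_norm w h < \<delta> \<longrightarrow>
        norm (power_sum N (x + h) *\<^sub>C y0 - power_sum N x *\<^sub>C y0 - L h) \<le> \<epsilon> * predual_norm w h)"
    by blast
qed

end

section \<open>Functions attaining their \<open>v\<close>-norm\<close>

context
  fixes w :: "nat \<Rightarrow> real"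
  assumes adm: "admissible w" and nsum: "\<not> summable w"
begin

text \<open>The segment from 0 to \<open>x\<close> is walked in \<open>m\<close> steps shorter than
  \<delta>, each raising the norm of \<open>g\<close> by less than 1, and \<open>m\<close> does not
  depend on \<open>x\<close>. Boundedness is what gives the real suprema in \<open>sup_norm\<close>
  and \<open>v_norm\<close> their meaning.\<close>

lemma unif_cont_on_ball_bounded:
  fixes g :: "(nat \<Rightarrow> complex) \<Rightarrow> 'y::complex_normed_vector"
  assumes "unif_cont_on_ball (predual_space w) (predual_norm w) g"
  shows "\<exists>B. \<forall>x\<in>open_unit_ball (predual_space w) (predual_norm w). norm (g x) \<le> B"
proof -
  let ?U = "open_unit_ball (predual_space w) (predual_norm w)"
  obtain \<delta> where \<delta>: "0 < \<delta>"
    "\<And>x y. x \<in> ?U \<Longrightarrow> y \<in> ?U \<Longrightarrow> predual_norm w (x - y) < \<delta> \<Longrightarrow> norm (g x - g y) < 1"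
    using assms unfolding unif_cont_on_ball_def by (meson zero_less_one)
  obtain m where m: "0 < m" "inverse (real m) < \<delta>"
    using ex_inverse_of_nat_less[OF \<delta>(1)] by blast
  have "norm (g x) \<le> norm (g 0) + real m" if x: "x \<in> ?U" for x
  proof -
    have X: "x \<in> predual_space w" and x1: "predual_norm w x < 1"
      using x by (auto simp: open_unit_ball_def)
    note x0 = predual_norm_nonneg[OF adm nsum X]
    define p where "p j = of_real (real j / real m) *\<^sub>C x" for j
    have pU: "p j \<in> ?U" if "j \<le> m" for j
    proof -
      have "real j / real m * predual_norm w x \<le> 1 * predual_norm w x"
        using that m(1) x0 by (intro mult_right_mono) auto
      then show ?thesis
        using x1 predual_space_scaleC[OF adm nsum X] unfolding p_def open_unit_ball_def
        by (simp add: norm_divide)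
    qed
    have "norm (g (p j)) \<le> norm (g 0) + real j" if "j \<le> m" for j
      using that
    proof (induction j)
      case 0
      have "p 0 = 0" by (simp add: p_def scaleC_fun_def scaleC_complex_def zero_fun_def)
      then show ?case by simp
    next
      case (Suc j)
      have "p (Suc j) - p j = of_real (inverse (real m)) *\<^sub>C x"
        by (simp add: p_def fun_eq_iff scaleC_fun_def scaleC_complex_def field_simps)
          (simp add: add_divide_distrib field_simps)
      then have "predual_norm w (p (Suc j) - p j) = inverse (real m) * predual_norm w x"
        using m(1) predual_space_scaleC(2)[OF adm nsum X] by (simp add: norm_inverse)
      also have "\<dots> \<le> inverse (real m) * 1"
        using x1 by (intro mult_left_mono) auto
      finally have "norm (g (p (Suc j)) - g (p j)) < 1"
        using m(2) Suc.prems by (intro \<delta>(2) pU) auto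
      then show ?case
        using Suc norm_triangle_ineq2[of "g (p (Suc j))" "g (p j)"] by simp
    qed
    from this[of m] show ?thesis
      using m(1) by (simp add: p_def scaleC_one)
  qed
  then show ?thesis by blast
qed

lemma norm_diff_le_sup_norm:
  fixes f g :: "(nat \<Rightarrow> complex) \<Rightarrow> 'y::complex_normed_vector"
  assumes "unif_cont_on_ball (predual_space w) (predual_norm w) f"
    and "unif_cont_on_ball (predual_space w) (predual_norm w) g"
    and "x \<in> open_unit_ball (predual_space w) (predual_norm w)"
  shows "norm (f x - g x) \<le> sup_norm (predual_space w) (predual_norm w) (f - g)"
proof -
  obtain B C where "\<And>x. x \<in> open_unit_ball (predual_space w) (predual_norm w) \<Longrightarrow> norm (f x) \<le> B"
    "\<And>x. x \<in> open_unit_ball (predual_space w) (predual_norm w) \<Longrightarrow> norm (g x) \<le> C"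
    using unif_cont_on_ball_bounded[OF assms(1)] unif_cont_on_ball_bounded[OF assms(2)] by blast
  then have "norm ((f - g) x) \<le> B + C" if "x \<in> open_unit_ball (predual_space w) (predual_norm w)" for x
    using that norm_triangle_ineq4[of "f x" "g x"] by fastforce
  then have "bdd_above ((\<lambda>x. norm ((f - g) x)) ` open_unit_ball (predual_space w) (predual_norm w))"
    by (rule bdd_aboveI2)
  from cSUP_upper[OF assms(3) this] show ?thesis
    by (simp add: sup_norm_def)
qed

lemma le_v_norm:
  fixes g :: "(nat \<Rightarrow> complex) \<Rightarrow> 'y::complex_normed_vector"
  assumes "unif_cont_on_ball (predual_space w) (predual_norm w) g"
    and "x \<in> open_unit_ball (predual_space w) (predual_norm w)"
  shows "(1 - (predual_norm w x)\<^sup>2) * norm (g x) \<le> v_norm (predual_space w) (predual_norm w) g"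
proof -
  obtain B where B: "\<And>x. x \<in> open_unit_ball (predual_space w) (predual_norm w) \<Longrightarrow> norm (g x) \<le> B"
    using unif_cont_on_ball_bounded[OF assms(1)] by blast
  have "(1 - (predual_norm w x)\<^sup>2) * norm (g x) \<le> B"
    if x: "x \<in> open_unit_ball (predual_space w) (predual_norm w)" for x
  proof -
    have "(1 - (predual_norm w x)\<^sup>2) * norm (g x) \<le> 1 * norm (g x)"
      by (intro mult_right_mono) auto
    then show ?thesis using B[OF x] by simp
  qed
  then have "bdd_above ((\<lambda>x. (1 - (predual_norm w x)\<^sup>2) * norm (g x)) `
      open_unit_ball (predual_space w) (predual_norm w))"
    by (rule bdd_aboveI2)
  from cSUP_upper[OF assms(2) this] show ?thesis
    by (simp add: v_norm_def)
qed

text \<open>Unit vectors have norm at most 1, so the line stays in the open ball for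
  \<open>cmod z < R\<close>. The chain rule for a functional and an affine map gives the derivative
  \<open>\<phi> (L (unit_seq n))\<close>.\<close>

lemma holomorphic_on_line:
  fixes g :: "(nat \<Rightarrow> complex) \<Rightarrow> 'y::complex_normed_vector" and \<phi> :: "'y \<Rightarrow> complex"
  assumes g: "holomorphic_on_ball (predual_space w) (predual_norm w) g"
    and x: "x \<in> predual_space w" "predual_norm w x + R \<le> 1"
    and add: "\<And>u v. \<phi> (u + v) = \<phi> u + \<phi> v" and scale: "\<And>c u. \<phi> (c *\<^sub>C u) = c * \<phi> u"
    and le: "\<And>u. cmod (\<phi> u) \<le> norm u"
  shows "(\<lambda>z. \<phi> (g (x + z *\<^sub>C unit_seq n))) holomorphic_on ball 0 R"
  unfolding holomorphic_on_open[OF open_ball]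
proof
  let ?e = "unit_seq n"
  note e = unit_seq_predual[OF adm nsum, of n]
  note ze = predual_space_scaleC(1)[OF adm nsum e]
  note nze = predual_norm_scaled_unit_seq[OF adm nsum, of _ n]
  have diff: "\<phi> (u - v) = \<phi> u - \<phi> v" for u v
    using add[of "u - v" v] by simp
  fix z :: complex assume "z \<in> ball 0 R"
  then have "predual_norm w (x + z *\<^sub>C ?e) < 1"
    using predual_space_add(2)[OF adm nsum x(1) ze[of z]] nze[of z] x(2) by simp
  then have "x + z *\<^sub>C ?e \<in> open_unit_ball (predual_space w) (predual_norm w)"
    using predual_space_add(1)[OF adm nsum x(1) ze[of z]] by (simp add: open_unit_ball_def)
  then obtain L where L: "bounded_clinear_on (predual_space w) (predual_norm w) L"
    and D: "\<And>\<epsilon>. 0 < \<epsilon> \<Longrightarrow> \<exists>\<delta>>0. \<forall>h\<in>predual_space w. predual_norm w h < \<delta> \<longrightarrow>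
      norm (g (x + z *\<^sub>C ?e + h) - g (x + z *\<^sub>C ?e) - L h) \<le> \<epsilon> * predual_norm w h"
    using g unfolding holomorphic_on_ball_def by blast
  have Lc: "L (c *\<^sub>C ?e) = c *\<^sub>C L ?e" for c
    using L e unfolding bounded_clinear_on_def by blast
  have "((\<lambda>z. \<phi> (g (x + z *\<^sub>C ?e))) has_field_derivative \<phi> (L ?e)) (at z)"
    unfolding has_field_derivative_def has_derivative_at_alt
  proof (intro conjI allI impI bounded_linear_mult_right)
    fix \<epsilon> :: real assume \<epsilon>: "0 < \<epsilon>"
    obtain \<delta> where \<delta>: "0 < \<delta>" "\<And>h. h \<in> predual_space w \<Longrightarrow> predual_norm w h < \<delta> \<Longrightarrow>
        norm (g (x + z *\<^sub>C ?e + h) - g (x + z *\<^sub>C ?e) - L h) \<le> \<epsilon> * predual_norm w h"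
      using D[OF \<epsilon>] by blast
    have "cmod (\<phi> (g (x + y *\<^sub>C ?e)) - \<phi> (g (x + z *\<^sub>C ?e)) - \<phi> (L ?e) * (y - z)) \<le> \<epsilon> * cmod (y - z)"
      if y: "cmod (y - z) < \<delta>" for y
    proof -
      let ?h = "(y - z) *\<^sub>C ?e"
      have "x + y *\<^sub>C ?e = x + z *\<^sub>C ?e + ?h"
        by (simp add: add.assoc flip: scaleC_add_left)
      then have "\<phi> (g (x + y *\<^sub>C ?e)) - \<phi> (g (x + z *\<^sub>C ?e)) - \<phi> (L ?e) * (y - z)
          = \<phi> (g (x + z *\<^sub>C ?e + ?h) - g (x + z *\<^sub>C ?e) - L ?h)"
        by (simp add: diff Lc scale mult.commute add.assoc)
      also have "cmod \<dots> \<le> \<epsilon> * predual_norm w ?h"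
        using nze[of "y - z"] y by (intro order_trans[OF le] \<delta>(2) ze) simp
      also have "\<dots> \<le> \<epsilon> * cmod (y - z)"
        using nze[of "y - z"] \<epsilon> by (intro mult_left_mono) auto
      finally show ?thesis .
    qed
    with \<delta>(1) show "\<exists>d>0. \<forall>y. cmod (y - z) < d \<longrightarrow>
        cmod (\<phi> (g (x + y *\<^sub>C ?e)) - \<phi> (g (x + z *\<^sub>C ?e)) - \<phi> (L ?e) * (y - z)) \<le> \<epsilon> * cmod (y - z)"
      by blast
  qed
  then show "\<exists>f'. ((\<lambda>z. \<phi> (g (x + z *\<^sub>C ?e))) has_field_derivative f') (at z)" by blast
qed

text \<open>Moving from \<open>x\<close> along a late unit vector does not increase the norm, so \<open>norm \<circ> g\<close> has a
  local maximum at \<open>x\<close> along this line.\<close>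

lemma constant_along_unit_seq:
  fixes g :: "(nat \<Rightarrow> complex) \<Rightarrow> 'y::complex_normed_vector"
  assumes sc: "strictly_convex TYPE('y)" and g: "g \<in> A_u (predual_space w) (predual_norm w)"
    and x: "x \<in> predual_space w" "x \<noteq> 0" "predual_norm w x < 1"
    and att: "v_norm (predual_space w) (predual_norm w) g = (1 - (predual_norm w x)\<^sup>2) * norm (g x)"
  shows "\<exists>m. \<forall>n\<ge>m. \<forall>z. predual_norm w x + cmod z < 1 \<longrightarrow> g (x + z *\<^sub>C unit_seq n) = g x"
proof -
  let ?r = "predual_norm w x"
  have hol: "holomorphic_on_ball (predual_space w) (predual_norm w) g"
    and uc: "unif_cont_on_ball (predual_space w) (predual_norm w) g"
    using g by (auto simp: A_u_def)
  obtain \<delta> m where "0 < \<delta>" and \<delta>: "\<And>n c. m \<le> n \<Longrightarrow> cmod c \<le> \<delta> \<Longrightarrow> predual_norm w (x + c *\<^sub>C unit_seq n) \<le> ?r"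
    using predual_norm_perturbation[OF adm nsum x(1,2)] by blast
  have r1: "0 \<le> ?r" "?r\<^sup>2 < 1"
    using x(3) predual_norm_nonneg[OF adm nsum x(1)] by (auto simp: power_less_one_iff abs_square_less_1)
  have "g (x + z *\<^sub>C unit_seq n) = g x" if n: "m \<le> n" and z: "?r + cmod z < 1" for n z
  proof -
    have zero: "x + 0 *\<^sub>C unit_seq n = x"
      by (simp add: fun_eq_iff scaleC_fun_def scaleC_complex_def)
    have "g (x + z *\<^sub>C unit_seq n) = g (x + 0 *\<^sub>C unit_seq n)"
    \<comment> \<open>The comparison of norms is available only up to \<delta>; the conclusion
      reaches the full radius \<open>1 - ?r\<close>.\<close>
    proof (rule strong_maximum_principle[OF sc, where R = "1 - ?r" and \<delta> = "min \<delta> (1 - ?r)"])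
      fix c assume c: "cmod c < min \<delta> (1 - ?r)"
      let ?y = "x + c *\<^sub>C unit_seq n"
      have yX: "?y \<in> predual_space w"
        by (intro predual_space_add(1) predual_space_scaleC(1) unit_seq_predual adm nsum x(1))
      have yr: "predual_norm w ?y \<le> ?r" using c by (intro \<delta> n) simp
      have "(1 - ?r\<^sup>2) * norm (g ?y) \<le> (1 - (predual_norm w ?y)\<^sup>2) * norm (g ?y)"
        using yr predual_norm_nonneg[OF adm nsum yX] by (intro mult_right_mono) (auto intro: power_mono)
      also have "\<dots> \<le> v_norm (predual_space w) (predual_norm w) g"
        using yX yr x(3) by (intro le_v_norm[OF uc]) (auto simp: open_unit_ball_def)
      finally have "(1 - ?r\<^sup>2) * norm (g ?y) \<le> (1 - ?r\<^sup>2) * norm (g x)" by (simp add: att)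
      then show "norm (g ?y) \<le> norm (g (x + 0 *\<^sub>C unit_seq n))"
        using r1(2) by (simp add: zero)
    next
      fix \<phi> :: "'y \<Rightarrow> complex"
      assume "\<And>u v. \<phi> (u + v) = \<phi> u + \<phi> v" "\<And>c u. \<phi> (c *\<^sub>C u) = c * \<phi> u"
        "\<And>u. cmod (\<phi> u) \<le> norm u"
      then show "(\<lambda>z. \<phi> (g (x + z *\<^sub>C unit_seq n))) holomorphic_on ball 0 (1 - ?r)"
        using x(1) by (intro holomorphic_on_line[OF hol]) auto
    qed (use \<open>0 < \<delta>\<close> x(3) z in auto)
    then show ?thesis by (simp only: zero)
  qed
  then show ?thesis by blast
qed

end

section \<open>The contradiction for functions close to the power sum\<close>

context
  fixes w :: "nat \<Rightarrow> real" and N :: nat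
  assumes adm: "admissible w" and nsum: "\<not> summable w"
    and wN: "summable (\<lambda>n. w n ^ N)" and N: "N \<ge> 2"
begin

lemma power_sum_shift:
  assumes x: "x \<in> predual_space w"
  shows "power_sum N (x + c *\<^sub>C unit_seq n) - power_sum N x = (x n + c) ^ N - x n ^ N"
proof -
  have "x + c *\<^sub>C unit_seq n \<in> predual_space w"
    by (intro predual_space_add(1) predual_space_scaleC(1) unit_seq_predual adm nsum x)
  then have "power_sum N (x + c *\<^sub>C unit_seq n) - power_sum N x
      = (\<Sum>k. (x + c *\<^sub>C unit_seq n) k ^ N - x k ^ N)"
    unfolding power_sum_def by (intro suminf_diff power_sum_summable[OF adm nsum wN N] x)
  also have "\<dots> = (\<Sum>k\<in>{n}. (x + c *\<^sub>C unit_seq n) k ^ N - x k ^ N)"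
    by (rule suminf_finite) (auto simp: scaleC_fun_def scaleC_complex_def unit_seq_def)
  finally show ?thesis by (simp add: scaleC_fun_def scaleC_complex_def unit_seq_def)
qed

lemma power_sum_not_approximable:
  fixes y0 :: "'y::complex_normed_vector"
  assumes sc: "strictly_convex TYPE('y)" and y0: "norm y0 = 1"
  shows "(\<lambda>x. power_sum N x *\<^sub>C y0)
    \<notin> sup_norm_closure (predual_space w) (predual_norm w) (NA_v_A_u (predual_space w) (predual_norm w))"
proof
  let ?X = "predual_space w" and ?n = "predual_norm w"
  let ?U = "open_unit_ball ?X ?n"
  define Q where "Q x = power_sum N x *\<^sub>C y0" for x
  define C where "C = (\<Sum>n. w n ^ N)"
  have C: "0 \<le> C" unfolding C_def by (rule suminf_weight_nonneg[OF adm nsum wN N])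
  \<comment> \<open>A lower bound for the weighted norm of \<open>Q\<close> at half of a unit
    vector: the value is \<open>(1 / 2) ^ N\<close> and the weight at least
    \<open>1 - 1 / 4\<close>.\<close>
  define a :: real where "a = 3 / 4 * (1 / 2) ^ N"
  \<comment> \<open>Chosen so that the estimate \<open>a / 2 \<le> (1 - ?n x) * 2 * (C + 1)\<close>
    below becomes \<open>2 * \<rho> \<le> 1 - ?n x\<close>; the factor 2 leaves strict room in the
    ball.\<close>
  define \<rho> where "\<rho> = a / (8 * (C + 1))"
  \<comment> \<open>The bound \<open>a / 4\<close> keeps the \<open>v\<close>-norm of
    \<open>g\<close> above \<open>a / 2\<close>; the bound \<open>\<rho> ^ N / 4\<close> contradicts
    the final \<open>\<rho> ^ N \<le> 2 * \<epsilon>\<close>.\<close>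
  define \<epsilon> where "\<epsilon> = min (a / 4) (\<rho> ^ N / 4)"
  have a: "0 < a" by (simp add: a_def)
  then have \<rho>: "0 < \<rho>" using C by (simp add: \<rho>_def)
  have \<epsilon>: "0 < \<epsilon>" "\<epsilon> \<le> a / 4" "\<epsilon> \<le> \<rho> ^ N / 4" using a \<rho> by (auto simp: \<epsilon>_def)
  \<comment> \<open>This makes \<epsilon> smaller than 1, so that \<open>norm (g x)\<close> exceeds
    the bound \<open>C\<close> for \<open>Q\<close> by at most 1.\<close>
  have "a \<le> 3 / 4 * 1" unfolding a_def by (intro mult_left_mono power_le_one) auto
  assume "(\<lambda>x. power_sum N x *\<^sub>C y0) \<in> sup_norm_closure ?X ?n (NA_v_A_u ?X ?n)"
  then have "Q \<in> sup_norm_closure ?X ?n (NA_v_A_u ?X ?n)" by (simp add: Q_def[abs_def])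
  then obtain g x where g: "g \<in> A_u ?X ?n" and Qg: "sup_norm ?X ?n (Q - g) < \<epsilon>"
    and x: "x \<in> closed_unit_ball ?X ?n" and att: "v_norm ?X ?n g = (1 - (?n x)\<^sup>2) * norm (g x)"
    using \<epsilon>(1) unfolding sup_norm_closure_def NA_v_A_u_def attains_v_norm_def by blast
  have uc: "unif_cont_on_ball ?X ?n g" using g by (simp add: A_u_def)
  have ucQ: "unif_cont_on_ball ?X ?n Q"
    unfolding Q_def[abs_def] by (rule power_sum_unif_cont[OF adm nsum wN N])
  have near: "norm (Q u - g u) < \<epsilon>" if "u \<in> ?U" for u
    using norm_diff_le_sup_norm[OF adm nsum ucQ uc that] Qg by simp
  have xX: "x \<in> ?X" and x1: "?n x \<le> 1" using x by (auto simp: closed_unit_ball_def)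
  have x0: "0 \<le> ?n x" by (rule predual_norm_nonneg[OF adm nsum xX])
  have normQ: "norm (Q u) = cmod (power_sum N u)" for u by (simp add: Q_def norm_scaleC y0)
  have low: "a - \<epsilon> \<le> v_norm ?X ?n g"
  proof -
    let ?u = "(1 / 2) *\<^sub>C unit_seq 0"
    have uX: "?u \<in> ?X" by (intro predual_space_scaleC(1) unit_seq_predual adm nsum)
    have un: "?n ?u \<le> 1 / 2" using predual_norm_scaled_unit_seq[OF adm nsum, of "1 / 2" 0] by (simp add: norm_divide)
    then have u2: "(?n ?u)\<^sup>2 \<le> (1 / 2)\<^sup>2"
      using predual_norm_nonneg[OF adm nsum uX] by (intro power_mono)
    have uU: "?u \<in> ?U" using uX un by (simp add: open_unit_ball_def)
    have "power_sum N ?u = (1 / 2) ^ N"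
      using power_sum_shift[OF zero_predual(1)[OF adm nsum], of "1 / 2" 0] N
      by (simp add: power_sum_def power_0_left)
    then have "norm (Q ?u) = (1 / 2) ^ N" by (simp add: normQ norm_power norm_divide)
    then have lb: "(1 / 2) ^ N - \<epsilon> \<le> norm (g ?u)"
      using near[OF uU] norm_triangle_ineq2[of "Q ?u" "g ?u"] by simp
    have "a - \<epsilon> \<le> 3 / 4 * ((1 / 2) ^ N - \<epsilon>)" using \<epsilon>(1) by (simp add: a_def)
    also have "\<dots> \<le> 3 / 4 * norm (g ?u)" using lb by simp
    also have "\<dots> \<le> (1 - (?n ?u)\<^sup>2) * norm (g ?u)"
      using u2 by (intro mult_right_mono) (auto simp: power2_eq_square)
    also have "\<dots> \<le> v_norm ?X ?n g" by (rule le_v_norm[OF adm nsum uc uU])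
    finally show ?thesis .
  qed
  \<comment> \<open>On the unit sphere the weight vanishes, so the \<open>v\<close>-norm would be 0
    whatever value \<open>g\<close> has there.\<close>
  have "?n x \<noteq> 1"
  proof
    assume "?n x = 1"
    then show False using low att a \<epsilon>(2) by simp
  qed
  then have x1: "?n x < 1" using x1 by simp
  have xU: "x \<in> ?U" using xX x1 by (simp add: open_unit_ball_def)
  \<comment> \<open>Since \<open>Q\<close> vanishes at 0, the norm of \<open>g\<close> there is
    below \<open>a / 4\<close>, too small for a \<open>v\<close>-norm of at least
    \<open>a - \<epsilon>\<close>.\<close>
  have "x \<noteq> 0"
  proof
    assume "x = 0"
    then have "Q x = 0" using N by (simp add: normQ power_sum_def power_0_left flip: norm_eq_zero)
    then have "norm (g x) < \<epsilon>" using near[OF xU] by simp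
    moreover have "(1 - (?n x)\<^sup>2) * norm (g x) \<le> 1 * norm (g x)" by (intro mult_right_mono) auto
    ultimately show False using low att \<epsilon>(1,2) a by linarith
  qed
  have "norm (Q x) \<le> C"
  proof -
    have "norm (Q x) \<le> ?n x ^ N * C"
      unfolding normQ C_def by (rule power_sum_le[OF adm nsum wN N xX])
    also have "\<dots> \<le> 1 * C" using x0 x1 C by (intro mult_right_mono power_le_one) auto
    finally show ?thesis by simp
  qed
  then have gx: "norm (g x) \<le> C + 1"
    using near[OF xU] norm_triangle_ineq3[of "Q x" "g x"] \<epsilon>(2) \<open>a \<le> 3 / 4 * 1\<close> by linarith
  have "a / 2 \<le> (1 - (?n x)\<^sup>2) * norm (g x)" using low att \<epsilon>(2) a by simp
  also have "(1 - (?n x)\<^sup>2) = (1 - ?n x) * (1 + ?n x)" by (simp add: power2_eq_square algebra_simps)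
  also have "(1 - ?n x) * (1 + ?n x) * norm (g x) \<le> (1 - ?n x) * 2 * (C + 1)"
    using x0 x1 gx by (intro mult_mono) auto
  finally have "\<rho> * 2 \<le> 1 - ?n x" using C by (simp add: \<rho>_def field_simps)
  then have \<rho>x: "?n x + cmod (of_real \<rho>) < 1" using \<rho> by simp
  obtain m where m: "\<And>n z. m \<le> n \<Longrightarrow> ?n x + cmod z < 1 \<Longrightarrow> g (x + z *\<^sub>C unit_seq n) = g x"
    using constant_along_unit_seq[OF adm nsum sc g xX \<open>x \<noteq> 0\<close> x1 att] by blast
  have "cmod ((x n + of_real \<rho>) ^ N - x n ^ N) \<le> 2 * \<epsilon>" if n: "m \<le> n" for n
  proof -
    let ?y = "x + of_real \<rho> *\<^sub>C unit_seq n"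
    note e = predual_space_scaleC(1)[OF adm nsum unit_seq_predual[OF adm nsum, of n], of "of_real \<rho>"]
    have yU: "?y \<in> ?U"
      using predual_space_add[OF adm nsum xX e] predual_norm_scaled_unit_seq[OF adm nsum, of "of_real \<rho>" n] \<rho>x
      by (simp add: open_unit_ball_def)
    have "cmod ((x n + of_real \<rho>) ^ N - x n ^ N) = norm (Q ?y - Q x)"
      by (simp add: Q_def norm_scaleC_diff y0 power_sum_shift[OF xX])
    also have "Q ?y - Q x = (Q ?y - g ?y) - (Q x - g x)" using m[OF n \<rho>x] by simp
    also have "norm \<dots> \<le> norm (Q ?y - g ?y) + norm (Q x - g x)" by (rule norm_triangle_ineq4)
    also have "\<dots> \<le> 2 * \<epsilon>" using near[OF yU] near[OF xU] by simp
    finally show ?thesis .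
  qed
  \<comment> \<open>The shift \<rho> is the same for all \<open>n\<close>, so the bound passes to
    the limit and only the power of \<rho> remains.\<close>
  moreover have "(\<lambda>n. cmod ((x n + of_real \<rho>) ^ N - x n ^ N)) \<longlonglongrightarrow> cmod ((0 + of_real \<rho>) ^ N - 0 ^ N)"
    by (intro tendsto_intros predual_tendsto_0[OF adm nsum xX])
  ultimately have "cmod ((0 + of_real \<rho>) ^ N - 0 ^ N) \<le> 2 * \<epsilon>"
    by (intro LIMSEQ_le_const2) auto
  then have "\<rho> ^ N \<le> 2 * \<epsilon>"
    using N \<rho> by (simp add: power_0_left norm_power)
  then show False using \<epsilon>(3) zero_less_power[OF \<rho>, of N] by simp
qed

end

text \<open>For summable \<open>w\<close> the set \<open>predual_space w\<close> would consist of 0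
  alone, and for a zero range every function vanishes and attains its \<open>v\<close>-norm; the
  hypotheses exclude both degenerate cases.\<close>

theorem theorem3p3:
  fixes w :: "nat \<Rightarrow> real" and N :: nat
  assumes "N \<ge> 2"
    and "admissible w"
    and "\<not> summable w"
    and "summable (\<lambda>n. w n ^ N)"
    and "strictly_convex TYPE('y::complex_banach)"
    and "\<exists>y::'y. y \<noteq> 0"
  shows "(\<exists>Q :: (nat \<Rightarrow> complex) \<Rightarrow> 'y.
           Q \<in> hom_polynomials (predual_space w) (predual_norm w) N \<and>
           Q \<notin> sup_norm_closure (predual_space w) (predual_norm w)
                 (NA_v_A_u (predual_space w) (predual_norm w))) \<and>
         \<not> (A_u (predual_space w) (predual_norm w) :: ((nat \<Rightarrow> complex) \<Rightarrow> 'y) set)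
             \<subseteq> sup_norm_closure (predual_space w) (predual_norm w)
                 (NA_v_A_u (predual_space w) (predual_norm w))"
proof -
  obtain y :: 'y where "y \<noteq> 0" using assms(6) by blast
  define y0 where "y0 = y /\<^sub>R norm y"
  have y0: "norm y0 = 1" using \<open>y \<noteq> 0\<close> by (simp add: y0_def)
  note a = assms(2,3,4,1)
  let ?Q = "\<lambda>x. power_sum N x *\<^sub>C y0"
  have "?Q \<in> A_u (predual_space w) (predual_norm w)"
    using power_sum_holomorphic[OF a, of y0] power_sum_unif_cont[OF a, of y0] by (simp add: A_u_def)
  then show ?thesis
    using power_sum_hom_polynomial[OF a, of y0] power_sum_not_approximable[OF a assms(5) y0] by blast
qed

end
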